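(* Let $E=\mathbb{F}_2^4=E_1\oplus E_2$ with $\dim E_1=\dim E_2=2$, and let $M=(E,r)$ be a $q$-matroid such that each of the minors $M|_{E_1}$, $M/E_2$, $M|_{E_2}$, $M/E_1$ is isomorphic to the uniform $q$-matroid $U_{1,2}$ over $\mathbb{F}_2$. If $M$ is representable, then $M$ does not have exactly $4$ circuits of dimension $2$. Moreover, there exists such a $q$-matroid $M$ with exactly $4$ circuits of dimension $2$, and hence it is an example of a non-representable $q$-matroid.
   Context: A $q$-matroid is a pair $(E,r)$, where $E$ is a finite-dimensional vector space over a field and $r$ is an integer-valued function on the set $\mathcal{L}(E)$ of subspaces of $E$ such that: (R1) $0\le r(A)\le\dim A$ for all $A$; (R2) $A\subseteq B$ implies $r(A)\le r(B)$; (R3) $r(A+B)+r(A\cap B)\le r(A)+r(B)$ for all $A,B$. A subspace $A$ is independent if $r(A)=\dim A$ and dependent otherwise; a circuit is a dependent subspace all of whose proper subspaces are independent. The uniform $q$-matroid $U_{k,n}$ has an $n$-dimensional ground space and rank function $r(A)=\min\{\dim A,k\}$. Two $q$-matroids $(E_1,r_1)$, $(E_2,r_2)$ over the same field are isomorphic if there is a lattice isomorphism $\varphi:\mathcal{L}(E_1)\to\mathcal{L}(E_2)$ with $r_1(A)=r_2(\varphi(A))$ for all $A\subseteq E_1$. For $X\subseteq E$, the restriction $M|_X$ has ground space $X$ and rank function $A\mapsto r(A)$; the contraction $M/X$ has ground space $E/X$ and rank function $A/X\mapsto r(A)-r(X)$ for $X\subseteq A\subseteq E$. A $q$-matroid $M=(E,r)$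 of rank $k=r(E)$ with $E=K^n$ over a field $K$ is representable if there exists a $k\times n$ matrix $G$ over some extension field $L/K$ such that for every subspace $A\subseteq E$ and every matrix $Y$ over $K$ with column space $A$, $r(A)$ equals the rank of $GY$ over $L$. *)

theory Defs
  imports
    "HOL-Algebra.Subrings"
    "HOL-Algebra.Weak_Morphisms"
    "HOL-Library.Z2"
    "Jordan_Normal_Form.DL_Rank"
begin

section \<open>Subspaces, quotient spaces and coordinate spaces\<close>

definition subspaces :: "('k, 'a) ring_scheme \<Rightarrow> ('k, 'v, 'b) module_scheme \<Rightarrow> 'v set set" where
  "subspaces K V = {A. VectorSpace.subspace K A V}"

definition sdim :: "('k, 'a) ring_scheme \<Rightarrow> ('k, 'v, 'b) module_scheme \<Rightarrow> 'v set \<Rightarrow> nat" where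
  "sdim K V A = vectorspace.dim K (V\<lparr>carrier := A\<rparr>)"

text \<open>The elements of the quotient space are the cosets of \<open>W\<close>. The fields \<open>mult\<close> and \<open>one\<close> of
  the record type of modules play no role for modules and are filled with dummies.\<close>

definition quot_space :: "('k, 'v, 'b) module_scheme \<Rightarrow> 'v set \<Rightarrow> ('k, 'v set) module" where
  "quot_space V W =
     \<lparr>carrier = a_rcosets\<^bsub>V\<^esub> W, mult = (\<lambda>_ _. W), one = W, zero = W,
      add = (\<lambda>C D. C <+>\<^bsub>V\<^esub> D),
      smult = (\<lambda>c C. \<Union>v\<in>C. W +>\<^bsub>V\<^esub> (c \<odot>\<^bsub>V\<^esub> v))\<rparr>"

definition coord_space :: "('k, 'a) ring_scheme \<Rightarrow> nat \<Rightarrow> ('k, nat \<Rightarrow> 'k) module" where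
  "coord_space K n = ring.func_space K {..<n}"

abbreviation F2 :: "bit ring" where
  "F2 \<equiv> class_ring"


section \<open>\<open>q\<close>-matroids\<close>

record ('k, 'v) qmat =
  ground :: "('k, 'v) module"
  rk :: "'v set \<Rightarrow> int"

text \<open>Only the values of \<open>rk\<close> on subspaces of the ground space are meaningful.\<close>

definition qmatroid :: "('k, 'a) ring_scheme \<Rightarrow> ('k, 'v) qmat \<Rightarrow> bool" where
  "qmatroid K M \<longleftrightarrow>
     vectorspace K (ground M) \<and> vectorspace.fin_dim K (ground M) \<and>
     (\<forall>A\<in>subspaces K (ground M). 0 \<le> rk M A \<and> rk M A \<le> int (sdim K (ground M) A)) \<and>
     (\<forall>A\<in>subspaces K (ground M). \<forall>B\<in>subspaces K (ground M). A \<subseteq> B \<longrightarrow> rk M A \<le> rk M B) \<and>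
     (\<forall>A\<in>subspaces K (ground M). \<forall>B\<in>subspaces K (ground M).
        rk M (A <+>\<^bsub>ground M\<^esub> B) + rk M (A \<inter> B) \<le> rk M A + rk M B)"

definition indep :: "('k, 'a) ring_scheme \<Rightarrow> ('k, 'v) qmat \<Rightarrow> 'v set \<Rightarrow> bool" where
  "indep K M A \<longleftrightarrow> A \<in> subspaces K (ground M) \<and> rk M A = int (sdim K (ground M) A)"

definition circuits :: "('k, 'a) ring_scheme \<Rightarrow> ('k, 'v) qmat \<Rightarrow> 'v set set" where
  "circuits K M =
     {C \<in> subspaces K (ground M). \<not> indep K M C \<and>
        (\<forall>A\<in>subspaces K (ground M). A \<subset> C \<longrightarrow> indep K M A)}"

definition circuits_of_dim :: "('k, 'a) ring_scheme \<Rightarrow> ('k, 'v) qmat \<Rightarrow> nat \<Rightarrow> 'v set set" where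
  "circuits_of_dim K M d = {C \<in> circuits K M. sdim K (ground M) C = d}"

definition uniform :: "('k, 'a) ring_scheme \<Rightarrow> nat \<Rightarrow> nat \<Rightarrow> ('k, nat \<Rightarrow> 'k) qmat" where
  "uniform K k n =
     \<lparr>ground = coord_space K n, rk = (\<lambda>A. int (min (sdim K (coord_space K n) A) k))\<rparr>"

definition restriction :: "('k, 'v) qmat \<Rightarrow> 'v set \<Rightarrow> ('k, 'v) qmat" where
  "restriction M W = \<lparr>ground = (ground M)\<lparr>carrier := W\<rparr>, rk = rk M\<rparr>"

text \<open>A subspace \<open>A/W\<close> of the quotient space is a set of cosets, and \<open>A\<close> is the union of them.\<close>

definition contraction :: "('k, 'v) qmat \<Rightarrow> 'v set \<Rightarrow> ('k, 'v set) qmat" where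
  "contraction M W =
     \<lparr>ground = quot_space (ground M) W, rk = (\<lambda>C. rk M (\<Union>C) - rk M W)\<rparr>"

definition lattice_iso ::
  "('k, 'a) ring_scheme \<Rightarrow> ('k, 'v) module \<Rightarrow> ('k, 'w) module \<Rightarrow> ('v set \<Rightarrow> 'w set) \<Rightarrow> bool" where
  "lattice_iso K V W \<phi> \<longleftrightarrow>
     bij_betw \<phi> (subspaces K V) (subspaces K W) \<and>
     (\<forall>A\<in>subspaces K V. \<forall>B\<in>subspaces K V.
        \<phi> (A \<inter> B) = \<phi> A \<inter> \<phi> B \<and> \<phi> (A <+>\<^bsub>V\<^esub> B) = \<phi> A <+>\<^bsub>W\<^esub> \<phi> B)"

definition isomorphic :: "('k, 'a) ring_scheme \<Rightarrow> ('k, 'v) qmat \<Rightarrow> ('k, 'w) qmat \<Rightarrow> bool" where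
  "isomorphic K M N \<longleftrightarrow>
     (\<exists>\<phi>. lattice_iso K (ground M) (ground N) \<phi> \<and>
          (\<forall>A\<in>subspaces K (ground M). rk M A = rk N (\<phi> A)))"


section \<open>Matrices over a field given by its carrier\<close>

definition mats :: "('k, 'a) ring_scheme \<Rightarrow> nat \<Rightarrow> nat \<Rightarrow> 'k mat set" where
  "mats K m p = {A \<in> carrier_mat m p. elements_mat A \<subseteq> carrier K}"

definition mat_prod :: "('k, 'a) ring_scheme \<Rightarrow> 'k mat \<Rightarrow> 'k mat \<Rightarrow> 'k mat" where
  "mat_prod K A B =
     mat (dim_row A) (dim_col B)
       (\<lambda>(i, j). \<Oplus>\<^bsub>K\<^esub>l\<in>{..<dim_col A}. A $$ (i, l) \<otimes>\<^bsub>K\<^esub> B $$ (l, j))"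

definition mat_cols :: "'k mat \<Rightarrow> (nat \<Rightarrow> 'k) set" where
  "mat_cols A = (\<lambda>j. \<lambda>i\<in>{..<dim_row A}. A $$ (i, j)) ` {..<dim_col A}"

definition column_space :: "('k, 'a) ring_scheme \<Rightarrow> 'k mat \<Rightarrow> (nat \<Rightarrow> 'k) set" where
  "column_space K A = LinearCombinations.module.span K (coord_space K (dim_row A)) (mat_cols A)"

definition mat_rank :: "('k, 'a) ring_scheme \<Rightarrow> 'k mat \<Rightarrow> nat" where
  "mat_rank K A = sdim K (coord_space K (dim_row A)) (column_space K A)"


section \<open>Representability\<close>

text \<open>The extension \<open>L/K\<close> is given by an embedding \<open>h\<close> of \<open>K\<close> into \<open>L\<close>; a homomorphism of fields
  (which preserves \<open>\<one>\<close>) is injective.\<close>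

definition representable_over ::
  "('k, 'a) ring_scheme \<Rightarrow> nat \<Rightarrow> ('k, nat \<Rightarrow> 'k) qmat \<Rightarrow> ('l, 'c) ring_scheme \<Rightarrow> bool" where
  "representable_over K n M L \<longleftrightarrow>
     ground M = coord_space K n \<and> field L \<and>
     (\<exists>h \<in> Ring.ring_hom K L. \<exists>G \<in> mats L (nat (rk M (carrier (ground M)))) n.
        \<forall>A\<in>subspaces K (ground M). \<forall>p. \<forall>Y\<in>mats K n p. column_space K Y = A \<longrightarrow>
          rk M A = int (mat_rank L (mat_prod L G (map_mat h Y))))"

text \<open>HOL cannot quantify over the type of the elements of the field \<open>L\<close>. Nothing is lost by taking
  all fields with elements in \<open>'k + nat\<close>: by \<open>representable_overD\<close> below, a representation over
  an extension field \<open>L\<close> with elements of any type yields one of this kind. (The subfield generated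
  by \<open>K\<close> and the entries of \<open>G\<close> has at most as many elements as \<open>'k + nat\<close>.)\<close>

definition representable ::
  "('k, 'a) ring_scheme \<Rightarrow> nat \<Rightarrow> ('k, nat \<Rightarrow> 'k) qmat \<Rightarrow> bool" where
  "representable K n M \<longleftrightarrow> (\<exists>L :: ('k + nat) ring. representable_over K n M L)"


section \<open>Quotient spaces are vector spaces\<close>

lemma quot_space_vectorspace:
  assumes "VectorSpace.subspace K W V"
  shows "vectorspace K (quot_space V W)"
proof -
  interpret V: vectorspace K V using assms by (simp add: VectorSpace.subspace_def)
  have sm: "LinearCombinations.submodule K W V" using assms by (simp add: VectorSpace.subspace_def)
  interpret W: LinearCombinations.submodule K W V by (rule sm)
  have WV: "W \<subseteq> carrier V" by (rule W.subset)
  have neg: "\<ominus>\<^bsub>V\<^esub> x \<in> W" if "x \<in> W" for x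
  proof -
    have "\<ominus>\<^bsub>V\<^esub> x = (\<ominus>\<^bsub>K\<^esub> \<one>\<^bsub>K\<^esub>) \<odot>\<^bsub>V\<^esub> x"
      using that WV by (metis V.R.one_closed V.smult_l_minus V.smult_one subsetD)
    then show ?thesis using that W.smult_closed by simp
  qed
  have sg: "subgroup W (add_monoid V)"
    using WV neg by (intro V.add.subgroupI) (auto simp: a_inv_def[symmetric] intro: W.zero_closed)
  interpret W2: abelian_subgroup W V
    by (rule abelian_subgroupI3) (auto simp: additive_subgroup_def sg intro: V.abelian_group_axioms)
  let ?c = "\<lambda>x. W +>\<^bsub>V\<^esub> x"
  have eq: "?c x = ?c y" if "x \<in> ?c y" "y \<in> carrier V" for x y
    using V.a_repr_independence[OF that sg] by simp
  have sm: "c \<odot>\<^bsub>quot_space V W\<^esub> ?c x = ?c (c \<odot>\<^bsub>V\<^esub> x)" if "c \<in> carrier K" "x \<in> carrier V" for c x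
  proof -
    have "?c (c \<odot>\<^bsub>V\<^esub> v) = ?c (c \<odot>\<^bsub>V\<^esub> x)" if "v \<in> ?c x" for v
    proof (rule eq)
      from that obtain w where w: "w \<in> W" "v = w \<oplus>\<^bsub>V\<^esub> x" by (auto simp: a_r_coset_def')
      then have "c \<odot>\<^bsub>V\<^esub> v = c \<odot>\<^bsub>V\<^esub> w \<oplus>\<^bsub>V\<^esub> c \<odot>\<^bsub>V\<^esub> x"
        using WV \<open>c \<in> _\<close> \<open>x \<in> _\<close> by (auto intro!: V.smult_r_distr)
      then show "c \<odot>\<^bsub>V\<^esub> v \<in> ?c (c \<odot>\<^bsub>V\<^esub> x)"
        using w \<open>c \<in> _\<close> by (auto simp: a_r_coset_def' intro!: bexI[of _ "c \<odot>\<^bsub>V\<^esub> w"] W.smult_closed)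
    qed (use \<open>c \<in> _\<close> \<open>x \<in> _\<close> in auto)
    moreover have "x \<in> ?c x" using that W.zero_closed by (auto simp: a_r_coset_def' intro!: bexI[of _ "\<zero>\<^bsub>V\<^esub>"])
    ultimately have "(\<Union>v\<in>?c x. ?c (c \<odot>\<^bsub>V\<^esub> v)) = ?c (c \<odot>\<^bsub>V\<^esub> x)" by blast
    then show ?thesis unfolding quot_space_def by simp
  qed
  have car: "carrier (quot_space V W) = ?c ` carrier V"
    by (auto simp: quot_space_def A_RCOSETS_def')
  have ad: "?c x \<oplus>\<^bsub>quot_space V W\<^esub> ?c y = ?c (x \<oplus>\<^bsub>V\<^esub> y)" if "x \<in> carrier V" "y \<in> carrier V" for x y
    using W2.a_rcos_sum[OF that] by (simp add: quot_space_def)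
  have z: "\<zero>\<^bsub>quot_space V W\<^esub> = ?c \<zero>\<^bsub>V\<^esub>" using WV by (simp add: quot_space_def)
  have ex: "\<exists>x\<in>carrier V. C = ?c x" if "C \<in> carrier (quot_space V W)" for C using that car by auto
  have mem: "?c x \<in> carrier (quot_space V W)" if "x \<in> carrier V" for x using that car by auto
  have "Module.module K (quot_space V W)"
  proof (rule Module.moduleI)
    show "cring K" by (rule V.R.cring_axioms)
    show "abelian_group (quot_space V W)"
    proof (rule abelian_groupI)
      show "\<zero>\<^bsub>quot_space V W\<^esub> \<in> carrier (quot_space V W)" unfolding z by (rule mem) simp
    next
      fix x y assume "x \<in> carrier (quot_space V W)" "y \<in> carrier (quot_space V W)"
      then obtain a b where ab: "a \<in> carrier V" "x = ?c a" "b \<in> carrier V" "y = ?c b" using ex by metis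
      show "x \<oplus>\<^bsub>quot_space V W\<^esub> y \<in> carrier (quot_space V W)" using ab ad mem by simp
      show "x \<oplus>\<^bsub>quot_space V W\<^esub> y = y \<oplus>\<^bsub>quot_space V W\<^esub> x" using ab ad V.M.a_comm by simp
      show "\<zero>\<^bsub>quot_space V W\<^esub> \<oplus>\<^bsub>quot_space V W\<^esub> x = x" using ab ad[of "\<zero>\<^bsub>V\<^esub>" a] z by simp
      show "\<exists>y\<in>carrier (quot_space V W). y \<oplus>\<^bsub>quot_space V W\<^esub> x = \<zero>\<^bsub>quot_space V W\<^esub>"
        by (rule bexI[of _ "?c (\<ominus>\<^bsub>V\<^esub> a)"]) (use ab ad[of "\<ominus>\<^bsub>V\<^esub> a" a] z V.M.l_neg mem in auto)
      fix w assume "w \<in> carrier (quot_space V W)"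
      then obtain d where d: "d \<in> carrier V" "w = ?c d" using ex by metis
      show "x \<oplus>\<^bsub>quot_space V W\<^esub> y \<oplus>\<^bsub>quot_space V W\<^esub> w = x \<oplus>\<^bsub>quot_space V W\<^esub> (y \<oplus>\<^bsub>quot_space V W\<^esub> w)"
        using ab d ad V.M.a_assoc by simp
    qed
  next
    fix a x assume "a \<in> carrier K" "x \<in> carrier (quot_space V W)"
    then show "a \<odot>\<^bsub>quot_space V W\<^esub> x \<in> carrier (quot_space V W)" using ex[of x] sm mem by auto
  next
    fix a b x assume "a \<in> carrier K" "b \<in> carrier K" "x \<in> carrier (quot_space V W)"
    then show "(a \<oplus>\<^bsub>K\<^esub> b) \<odot>\<^bsub>quot_space V W\<^esub> x = a \<odot>\<^bsub>quot_space V W\<^esub> x \<oplus>\<^bsub>quot_space V W\<^esub> b \<odot>\<^bsub>quot_space V W\<^esub> x"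
       "(a \<otimes>\<^bsub>K\<^esub> b) \<odot>\<^bsub>quot_space V W\<^esub> x = a \<odot>\<^bsub>quot_space V W\<^esub> (b \<odot>\<^bsub>quot_space V W\<^esub> x)"
       using ex[of x] by (auto simp: sm ad V.smult_l_distr V.smult_assoc1)
  next
    fix a x y assume "a \<in> carrier K" "x \<in> carrier (quot_space V W)" "y \<in> carrier (quot_space V W)"
    then show "a \<odot>\<^bsub>quot_space V W\<^esub> (x \<oplus>\<^bsub>quot_space V W\<^esub> y) = a \<odot>\<^bsub>quot_space V W\<^esub> x \<oplus>\<^bsub>quot_space V W\<^esub> a \<odot>\<^bsub>quot_space V W\<^esub> y"
      using ex[of x] ex[of y] by (auto simp: sm ad V.smult_r_distr)
  next
    fix x assume "x \<in> carrier (quot_space V W)"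
    then show "\<one>\<^bsub>K\<^esub> \<odot>\<^bsub>quot_space V W\<^esub> x = x" using ex[of x] by (auto simp: sm)
  qed
  then show ?thesis by (simp add: vectorspace_def V.field_axioms)
qed


section \<open>Representability does not depend on the type of the extension field\<close>

text \<open>The rank of a matrix does not change under field extensions.\<close>

lemma coord_space_simps:
  "carrier (coord_space K n) = {..<n} \<rightarrow>\<^sub>E carrier K"
  "\<zero>\<^bsub>coord_space K n\<^esub> = (\<lambda>i\<in>{..<n}. \<zero>\<^bsub>K\<^esub>)"
  "x \<oplus>\<^bsub>coord_space K n\<^esub> y = (\<lambda>i\<in>{..<n}. x i \<oplus>\<^bsub>K\<^esub> y i)"
  "c \<odot>\<^bsub>coord_space K n\<^esub> x = (\<lambda>i\<in>{..<n}. c \<otimes>\<^bsub>K\<^esub> x i)"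
  if "field K"
proof -
  interpret field K by fact
  show "carrier (coord_space K n) = {..<n} \<rightarrow>\<^sub>E carrier K"
    "\<zero>\<^bsub>coord_space K n\<^esub> = (\<lambda>i\<in>{..<n}. \<zero>\<^bsub>K\<^esub>)"
    "x \<oplus>\<^bsub>coord_space K n\<^esub> y = (\<lambda>i\<in>{..<n}. x i \<oplus>\<^bsub>K\<^esub> y i)"
    "c \<odot>\<^bsub>coord_space K n\<^esub> x = (\<lambda>i\<in>{..<n}. c \<otimes>\<^bsub>K\<^esub> x i)"
    by (simp_all add: coord_space_def func_space_def)
qed

lemma coord_space_memI:
  "field K \<Longrightarrow> (\<And>i. i < n \<Longrightarrow> v i \<in> carrier K) \<Longrightarrow> (\<lambda>i\<in>{..<n}. v i) \<in> carrier (coord_space K n)"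
  by (simp add: coord_space_simps)

lemma coord_space_memD:
  "field K \<Longrightarrow> v \<in> carrier (coord_space K n) \<Longrightarrow> i < n \<Longrightarrow> v i \<in> carrier K"
  by (auto simp: coord_space_simps)

lemma coord_space_vectorspace:
  assumes "field K"
  shows "vectorspace K (coord_space K n)"
proof -
  interpret field K by fact
  show ?thesis
    unfolding vectorspace_def coord_space_def
    using func_space_is_module field_axioms by blast
qed

definition unit_vec_on :: "('k, 'a) ring_scheme \<Rightarrow> nat \<Rightarrow> nat \<Rightarrow> nat \<Rightarrow> 'k" where
  "unit_vec_on K n j = (\<lambda>i\<in>{..<n}. if i = j then \<one>\<^bsub>K\<^esub> else \<zero>\<^bsub>K\<^esub>)"

lemma unit_vec_on_carrier:
  assumes "field K"
  shows "unit_vec_on K n j \<in> carrier (coord_space K n)"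
proof -
  interpret field K by fact
  show ?thesis by (auto simp: coord_space_simps[OF assms] unit_vec_on_def split: if_splits)
qed

lemma unit_vecs_span:
  assumes "field K"
  shows "LinearCombinations.module.span K (coord_space K n) (unit_vec_on K n ` {..<n}) =
         carrier (coord_space K n)" (is "?S = ?C")
proof -
  interpret V: vectorspace K "coord_space K n"
    using assms by (rule coord_space_vectorspace)
  interpret field K by fact
  note cs = coord_space_simps[OF assms]
  let ?U = "unit_vec_on K n ` {..<n}"
  have U: "?U \<subseteq> ?C"
    using unit_vec_on_carrier[OF assms] by blast
  interpret S: LinearCombinations.submodule K ?S "coord_space K n"
    using V.span_is_submodule[OF U] .
  have in_span: "v \<in> ?S" if "v \<in> ?C" "\<And>i. i \<in> {j..<n} \<Longrightarrow> v i = \<zero>\<^bsub>K\<^esub>" "j \<le> n" for v j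
    using that
  proof (induction j arbitrary: v)
    case 0
    then have "v = \<zero>\<^bsub>coord_space K n\<^esub>"
      by (auto simp: cs fun_eq_iff PiE_def extensional_def)
    then show ?case by simp
  next
    case (Suc j)
    define w where "w = (\<lambda>i\<in>{..<n}. if i = j then \<zero>\<^bsub>K\<^esub> else v i)"
    have vi: "i < n \<Longrightarrow> v i \<in> carrier K" for i
      using Suc.prems(1) by (auto simp: cs)
    have "w \<in> ?S"
    proof (rule Suc.IH)
      show "w \<in> ?C" using vi by (auto simp: w_def cs)
      show "w i = \<zero>\<^bsub>K\<^esub>" if "i \<in> {j..<n}" for i
        using that Suc.prems(2) by (auto simp: w_def)
      show "j \<le> n" using Suc.prems(3) by simp
    qed
    moreover have "unit_vec_on K n j \<in> ?S"
      using V.in_own_span[OF U] Suc.prems(3) by auto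
    moreover have "v j \<in> carrier K"
      using vi Suc.prems(3) by auto
    ultimately have "w \<oplus>\<^bsub>coord_space K n\<^esub> (v j \<odot>\<^bsub>coord_space K n\<^esub> unit_vec_on K n j) \<in> ?S"
      by auto
    moreover have "w \<oplus>\<^bsub>coord_space K n\<^esub> (v j \<odot>\<^bsub>coord_space K n\<^esub> unit_vec_on K n j) = v"
    proof
      fix i
      show "(w \<oplus>\<^bsub>coord_space K n\<^esub> (v j \<odot>\<^bsub>coord_space K n\<^esub> unit_vec_on K n j)) i = v i"
        using vi[of i] vi[of j] Suc.prems(1,3)
        by (auto simp: cs w_def unit_vec_on_def PiE_def extensional_def)
    qed
    ultimately show ?case by simp
  qed
  show ?thesis
  proof
    show "?S \<subseteq> ?C" using V.span_is_subset2[OF U] .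
    show "?C \<subseteq> ?S" using in_span[of _ n] by auto
  qed
qed

lemma unit_vecs_indpt:
  assumes "field K" "m \<le> n"
  shows "\<not> LinearCombinations.module.lin_dep K (coord_space K n) (unit_vec_on K n ` {..<m})"
  using assms(2)
proof (induction m)
  interpret V: vectorspace K "coord_space K n"
    using assms(1) by (rule coord_space_vectorspace)
  {
    case 0
    then show ?case by (simp add: V.lin_dep_def)
  next
    case (Suc m)
    interpret field K by fact
    note cs = coord_space_simps[OF assms(1)]
    let ?U = "unit_vec_on K n ` {..<m}" and ?Z = "{v \<in> carrier (coord_space K n). v m = \<zero>\<^bsub>K\<^esub>}"
    have U: "?U \<subseteq> carrier (coord_space K n)"
      using unit_vec_on_carrier[OF assms(1)] by blast
    have "LinearCombinations.submodule K ?Z (coord_space K n)"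
      using Suc.prems V.module.module_axioms
      by (auto simp: LinearCombinations.submodule_def cs PiE_def)
    moreover have "?U \<subseteq> ?Z"
      using Suc.prems U by (auto simp: unit_vec_on_def)
    ultimately have sub: "V.span ?U \<subseteq> ?Z"
      using V.span_is_subset by blast
    have e: "unit_vec_on K n m \<in> carrier (coord_space K n)" "unit_vec_on K n m m = \<one>\<^bsub>K\<^esub>"
      using Suc.prems by (auto simp: unit_vec_on_def cs)
    have "unit_vec_on K n m \<notin> V.span ?U"
      using sub e by auto
    moreover have "unit_vec_on K n m \<notin> ?U"
      using calculation V.in_own_span[OF U] by auto
    ultimately have "\<not> V.lin_dep (?U \<union> {unit_vec_on K n m})"
      using V.lin_dep_iff_in_span[OF U] Suc e by auto
    then show ?case by (simp add: lessThan_Suc)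
  }
qed

lemma coord_space_dim:
  assumes "field K"
  shows "vectorspace.dim K (coord_space K n) = n"
    and "vectorspace.fin_dim K (coord_space K n)"
    and "card (unit_vec_on K n ` {..<n}) = n"
proof -
  interpret V: vectorspace K "coord_space K n"
    using assms by (rule coord_space_vectorspace)
  interpret field K by fact
  have "inj_on (unit_vec_on K n) {..<n}"
  proof (rule inj_onI)
    fix i j
    assume "i \<in> {..<n}" "j \<in> {..<n}" "unit_vec_on K n i = unit_vec_on K n j"
    then have "i < n" "unit_vec_on K n i i = unit_vec_on K n j i" by auto
    then show "i = j"
      by (auto simp: unit_vec_on_def split: if_splits)
  qed
  then show c: "card (unit_vec_on K n ` {..<n}) = n"
    by (simp add: card_image)
  have U: "unit_vec_on K n ` {..<n} \<subseteq> carrier (coord_space K n)"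
    using unit_vec_on_carrier[OF assms] by blast
  have basis: "V.basis (unit_vec_on K n ` {..<n})"
    unfolding V.basis_def using U unit_vecs_span[OF assms] unit_vecs_indpt[OF assms order_refl] by blast
  show "V.dim = n"
    using V.dim_basis[OF _ basis] c by (metis finite_imageI finite_lessThan)
  show "V.fin_dim"
    unfolding V.fin_dim_def using U unit_vecs_span[OF assms] finite_imageI[OF finite_lessThan] by metis
qed

lemma mats_dims: "A \<in> mats K m p \<Longrightarrow> dim_row A = m" "A \<in> mats K m p \<Longrightarrow> dim_col A = p"
  by (auto simp: mats_def)

lemma mats_entry:
  assumes "A \<in> mats K m p" "i < m" "j < p"
  shows "A $$ (i, j) \<in> carrier K"
proof -
  have "A $$ (i, j) \<in> elements_mat A"
    using assms by (intro elements_matI) (auto simp: mats_def)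
  then show ?thesis using assms(1) by (auto simp: mats_def)
qed

lemma matsI:
  "A \<in> carrier_mat m p \<Longrightarrow> (\<And>i j. i < m \<Longrightarrow> j < p \<Longrightarrow> A $$ (i, j) \<in> carrier K) \<Longrightarrow> A \<in> mats K m p"
  by (auto simp: mats_def elements_mat_def)

lemma mat_cols_carrier:
  assumes "field K" "A \<in> mats K m p"
  shows "mat_cols A \<subseteq> carrier (coord_space K m)"
  using mats_dims[OF assms(2)] mats_entry[OF assms(2)]
  by (auto simp: mat_cols_def intro!: coord_space_memI[OF assms(1)])

locale field_embedding =
  K: field K + L: field L for K (structure) and L (structure) +
  fixes f
  assumes hom: "f \<in> Ring.ring_hom K L"
begin

lemma f_simps [simp]:
  "x \<in> carrier K \<Longrightarrow> f x \<in> carrier L"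
  "x \<in> carrier K \<Longrightarrow> y \<in> carrier K \<Longrightarrow> f (x \<otimes>\<^bsub>K\<^esub> y) = f x \<otimes>\<^bsub>L\<^esub> f y"
  "x \<in> carrier K \<Longrightarrow> y \<in> carrier K \<Longrightarrow> f (x \<oplus>\<^bsub>K\<^esub> y) = f x \<oplus>\<^bsub>L\<^esub> f y"
  "f \<one>\<^bsub>K\<^esub> = \<one>\<^bsub>L\<^esub>"
  "f \<zero>\<^bsub>K\<^esub> = \<zero>\<^bsub>L\<^esub>"
  using hom by (auto simp: Ring.ring_hom_def intro: ring_hom_zero[OF hom K.ring_axioms L.ring_axioms])

lemma f_inj: "inj_on f (carrier K)"
proof -
  interpret ring_hom_ring K L f
    using hom by (intro ring_hom_ringI2 K.ring_axioms L.ring_axioms)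
  show ?thesis
    using non_trivial_field_hom_is_inj[OF hom K.field_axioms L.field_axioms] by simp
qed

definition scalar_ext :: "nat \<Rightarrow> (nat \<Rightarrow> 'a) \<Rightarrow> nat \<Rightarrow> 'c" where
  "scalar_ext n v = (\<lambda>i\<in>{..<n}. f (v i))"

lemma scalar_ext_inj: "inj_on (scalar_ext n) (carrier (coord_space K n))"
proof (rule inj_onI)
  fix v w
  assume *: "v \<in> carrier (coord_space K n)" "w \<in> carrier (coord_space K n)" "scalar_ext n v = scalar_ext n w"
  have eq: "v i = w i" if "i < n" for i
  proof (rule inj_onD[OF f_inj])
    show "f (v i) = f (w i)"
      using fun_cong[OF *(3), of i] that by (simp add: scalar_ext_def)
    show "v i \<in> carrier K" "w i \<in> carrier K"
      using coord_space_memD[OF K.field_axioms] that * by blast+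
  qed
  show "v = w"
    using * eq unfolding coord_space_simps(1)[OF K.field_axioms] by (intro PiE_ext) auto
qed

lemmas KV = coord_space_vectorspace[OF K.field_axioms]
lemmas LV = coord_space_vectorspace[OF L.field_axioms]
lemmas K_memD = coord_space_memD[OF K.field_axioms]
lemmas csK = coord_space_simps[OF K.field_axioms]
lemmas csL = coord_space_simps[OF L.field_axioms]

lemma scalar_ext_closed: "v \<in> carrier (coord_space K n) \<Longrightarrow> scalar_ext n v \<in> carrier (coord_space L n)"
  unfolding scalar_ext_def by (intro coord_space_memI L.field_axioms f_simps K_memD)

lemma scalar_ext_zero: "scalar_ext n \<zero>\<^bsub>coord_space K n\<^esub> = \<zero>\<^bsub>coord_space L n\<^esub>"
  unfolding scalar_ext_def csK csL by (intro restrict_ext) simp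

lemma scalar_ext_add:
  assumes "v \<in> carrier (coord_space K n)" "w \<in> carrier (coord_space K n)"
  shows "scalar_ext n (v \<oplus>\<^bsub>coord_space K n\<^esub> w) = scalar_ext n v \<oplus>\<^bsub>coord_space L n\<^esub> scalar_ext n w"
  unfolding scalar_ext_def csK csL using K_memD[OF assms(1)] K_memD[OF assms(2)]
  by (intro restrict_ext) simp

lemma scalar_ext_smult:
  assumes "c \<in> carrier K" "v \<in> carrier (coord_space K n)"
  shows "scalar_ext n (c \<odot>\<^bsub>coord_space K n\<^esub> v) = f c \<odot>\<^bsub>coord_space L n\<^esub> scalar_ext n v"
  unfolding scalar_ext_def csK csL using K_memD[OF assms(2)] assms(1)
  by (intro restrict_ext) simp

lemma scalar_ext_span:
  assumes "B \<subseteq> carrier (coord_space K n)"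
    and "v \<in> LinearCombinations.module.span K (coord_space K n) B"
  shows "scalar_ext n v \<in> LinearCombinations.module.span L (coord_space L n) (scalar_ext n ` B)"
proof -
  interpret KV: vectorspace K "coord_space K n" by (rule KV)
  interpret LV: vectorspace L "coord_space L n" by (rule LV)
  let ?S = "LV.span (scalar_ext n ` B)"
  have B: "scalar_ext n ` B \<subseteq> carrier (coord_space L n)"
    using assms(1) scalar_ext_closed by blast
  interpret S: LinearCombinations.submodule L ?S "coord_space L n"
    using LV.span_is_submodule[OF B] .
  have "LinearCombinations.submodule K {v \<in> carrier (coord_space K n). scalar_ext n v \<in> ?S} (coord_space K n)"
  proof (rule LinearCombinations.submodule.intro)
    show "Module.module K (coord_space K n)"
      by (rule KV.module.module_axioms)
    show "{v \<in> carrier (coord_space K n). scalar_ext n v \<in> ?S} \<subseteq> carrier (coord_space K n)"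
      by (rule Collect_restrict)
    show "\<zero>\<^bsub>coord_space K n\<^esub> \<in> {v \<in> carrier (coord_space K n). scalar_ext n v \<in> ?S}"
      using KV.M.zero_closed S.zero_closed unfolding scalar_ext_zero[symmetric] by blast
  next
    fix v w
    assume *: "v \<in> {v \<in> carrier (coord_space K n). scalar_ext n v \<in> ?S}"
      "w \<in> {v \<in> carrier (coord_space K n). scalar_ext n v \<in> ?S}"
    then have "scalar_ext n (v \<oplus>\<^bsub>coord_space K n\<^esub> w) = scalar_ext n v \<oplus>\<^bsub>coord_space L n\<^esub> scalar_ext n w"
      by (intro scalar_ext_add) blast+
    then show "v \<oplus>\<^bsub>coord_space K n\<^esub> w \<in> {v \<in> carrier (coord_space K n). scalar_ext n v \<in> ?S}"
      using * S.m_closed KV.M.add.m_closed by (metis (lifting) mem_Collect_eq)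
  next
    fix c v
    assume *: "c \<in> carrier K" "v \<in> {v \<in> carrier (coord_space K n). scalar_ext n v \<in> ?S}"
    then have "scalar_ext n (c \<odot>\<^bsub>coord_space K n\<^esub> v) = f c \<odot>\<^bsub>coord_space L n\<^esub> scalar_ext n v"
      by (intro scalar_ext_smult) blast+
    then show "c \<odot>\<^bsub>coord_space K n\<^esub> v \<in> {v \<in> carrier (coord_space K n). scalar_ext n v \<in> ?S}"
      using * S.smult_closed KV.smult_closed f_simps(1) by (metis (lifting) mem_Collect_eq)
  qed
  moreover have "B \<subseteq> {v \<in> carrier (coord_space K n). scalar_ext n v \<in> ?S}"
    using assms(1) LV.in_own_span[OF B] by blast
  ultimately have "KV.span B \<subseteq> {v \<in> carrier (coord_space K n). scalar_ext n v \<in> ?S}"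
    using KV.span_is_subset by blast
  then show ?thesis using assms(2) by blast
qed

lemma scalar_ext_indpt:
  assumes B: "finite B" "B \<subseteq> carrier (coord_space K n)"
    "\<not> LinearCombinations.module.lin_dep K (coord_space K n) B"
  shows "\<not> LinearCombinations.module.lin_dep L (coord_space L n) (scalar_ext n ` B)"
proof -
  interpret KV: vectorspace K "coord_space K n" by (rule KV)
  interpret LV: vectorspace L "coord_space L n" by (rule LV)
  let ?U = "unit_vec_on K n ` {..<n}" and ?UL = "unit_vec_on L n ` {..<n}"
  have U: "?U \<subseteq> carrier (coord_space K n)"
    using unit_vec_on_carrier[OF K.field_axioms] by blast
  have UL: "?UL \<subseteq> carrier (coord_space L n)"
    using unit_vec_on_carrier[OF L.field_axioms] by blast
  obtain C where C: "finite C" "C \<subseteq> carrier (coord_space K n)"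
      "int (card C) \<le> int (card ?U) - int (card B)" "KV.span (B \<union> C) = KV.span ?U"
    using KV.replacement[of B ?U] B U unit_vecs_span[OF K.field_axioms] by auto
  define D where "D = scalar_ext n ` (B \<union> C)"
  have D: "D \<subseteq> carrier (coord_space L n)" "finite D"
    using B C scalar_ext_closed by (auto simp: D_def)
  have "card D \<le> card (B \<union> C)"
    using B C by (simp add: D_def card_image_le)
  also have "\<dots> \<le> n"
    using C(3) card_Un_le[of B C] coord_space_dim(3)[OF K.field_axioms, of n] by linarith
  finally have cD: "card D \<le> n" .
  have "?UL \<subseteq> LV.span D"
  proof
    fix u assume "u \<in> ?UL"
    then obtain j where j: "j < n" "u = unit_vec_on L n j" by auto
    have "unit_vec_on K n j \<in> KV.span (B \<union> C)"
      using C(4) KV.in_own_span[OF U] j by auto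
    then have "scalar_ext n (unit_vec_on K n j) \<in> LV.span D"
      unfolding D_def using B C by (intro scalar_ext_span) auto
    moreover have "scalar_ext n (unit_vec_on K n j) = u"
      using j by (auto simp: scalar_ext_def unit_vec_on_def)
    ultimately show "u \<in> LV.span D" by simp
  qed
  then have "LV.span ?UL \<subseteq> LV.span D"
    using LV.span_is_subset LV.span_is_submodule[OF D(1)] by blast
  then have "LV.span D = carrier (coord_space L n)"
    using unit_vecs_span[OF L.field_axioms, of n] LV.span_is_subset2[OF D(1)] by blast
  then have "LV.basis D"
    using LV.dim_gen_is_basis[OF D(2,1)] cD coord_space_dim(1)[OF L.field_axioms, of n] by simp
  then have "\<not> LV.lin_dep D"
    by (simp add: LV.basis_def)
  then show ?thesis
    using LV.subset_li_is_li[of D "scalar_ext n ` B"] by (auto simp: D_def)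
qed

lemma mat_rank_map:
  assumes A: "A \<in> mats K m p"
  shows "mat_rank L (map_mat f A) = mat_rank K A"
proof -
  note dims = mats_dims[OF A]
  let ?C = "mat_cols A" and ?CL = "mat_cols (map_mat f A)"
  have C: "?C \<subseteq> carrier (coord_space K m)" "finite ?C"
    using mat_cols_carrier[OF K.field_axioms A] by (auto simp: mat_cols_def)
  have CL: "?CL = scalar_ext m ` ?C"
    unfolding mat_cols_def image_image dims index_map_mat scalar_ext_def
    by (intro image_cong refl restrict_ext) (simp add: dims)
  interpret KV: vectorspace K "coord_space K m" by (rule KV)
  interpret LV: vectorspace L "coord_space L m" by (rule LV)
  have CL': "?CL \<subseteq> carrier (coord_space L m)" "finite ?CL"
    using C(2) scalar_ext_closed subsetD[OF C(1)] unfolding CL by blast+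
  obtain B where B: "maximal B (\<lambda>T. T \<subseteq> ?C \<and> \<not> KV.lin_dep T)"
    using maximal_exists_superset[of ?C "\<lambda>T. T \<subseteq> ?C \<and> \<not> KV.lin_dep T" "{}"] C
    unfolding KV.lin_dep_def by blast
  then have B': "B \<subseteq> ?C" "\<not> KV.lin_dep B"
    unfolding maximal_def by blast+
  have finB: "finite B"
    using B'(1) C(2) by (rule finite_subset)
  have BC: "B \<subseteq> carrier (coord_space K m)"
    using B' C by blast
  have *: "scalar_ext m ` B \<subseteq> carrier (coord_space L m)"
    using BC scalar_ext_closed by blast
  have li: "\<not> LV.lin_dep (scalar_ext m ` B)"
    using scalar_ext_indpt[OF finB BC B'(2)] .
  have "maximal (scalar_ext m ` B) (\<lambda>T. T \<subseteq> ?CL \<and> \<not> LV.lin_dep T)"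
    unfolding maximal_def
  proof (intro conjI allI impI; (elim conjE)?)
    show "scalar_ext m ` B \<subseteq> ?CL" using B' unfolding CL by blast
    show "\<not> LV.lin_dep (scalar_ext m ` B)" by (rule li)
    fix S assume S: "scalar_ext m ` B \<subseteq> S" "S \<subseteq> ?CL" "\<not> LV.lin_dep S"
    show "S = scalar_ext m ` B"
    proof (rule ccontr)
      assume "S \<noteq> scalar_ext m ` B"
      then obtain c where c: "c \<in> ?C" "scalar_ext m c \<in> S" "scalar_ext m c \<notin> scalar_ext m ` B"
        using S unfolding CL by blast
      then have "c \<notin> B" by blast
      then have "KV.lin_dep (B \<union> {c})"
        using B c(1) unfolding maximal_def by blast
      then have "c \<in> KV.span B"
        using KV.lin_dep_iff_in_span[OF BC B'(2)] c(1) C \<open>c \<notin> B\<close> by blast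
      then have "scalar_ext m c \<in> LV.span (scalar_ext m ` B)"
        using scalar_ext_span BC by blast
      then have "LV.lin_dep (scalar_ext m ` B \<union> {scalar_ext m c})"
        using LV.lin_dep_iff_in_span[OF * li] c C scalar_ext_closed by blast
      moreover have "scalar_ext m ` B \<union> {scalar_ext m c} \<subseteq> S"
        using S(1) c(2) by blast
      ultimately show False
        using S(3) LV.subset_li_is_li by blast
    qed
  qed
  then have "mat_rank L (map_mat f A) = card (scalar_ext m ` B)"
    unfolding mat_rank_def column_space_def sdim_def
    using LV.dim_span[OF CL'] by (simp add: dims)
  also have "\<dots> = card B"
    using scalar_ext_inj BC by (intro card_image) (blast intro: inj_on_subset)
  also have "\<dots> = mat_rank K A"
    unfolding mat_rank_def column_space_def sdim_def
    using KV.dim_span[OF C B] by (simp add: dims)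
  finally show ?thesis .
qed

lemma map_mat_prod:
  assumes A: "A \<in> mats K m n" and B: "B \<in> mats K n p"
  shows "map_mat f (mat_prod K A B) = mat_prod L (map_mat f A) (map_mat f B)"
    and "mat_prod K A B \<in> mats K m p"
proof -
  interpret ring_hom_cring K L f
    using hom by unfold_locales
  note dims = mats_dims[OF A] mats_dims[OF B]
  note entry = mats_entry[OF A] mats_entry[OF B]
  show "map_mat f (mat_prod K A B) = mat_prod L (map_mat f A) (map_mat f B)"
  proof (rule eq_matI)
    fix i j
    assume "i < dim_row (mat_prod L (map_mat f A) (map_mat f B))"
      and "j < dim_col (mat_prod L (map_mat f A) (map_mat f B))"
    then have ij: "i < m" "j < p" by (simp_all add: mat_prod_def dims)
    have "f (\<Oplus>\<^bsub>K\<^esub>l\<in>{..<n}. A $$ (i, l) \<otimes>\<^bsub>K\<^esub> B $$ (l, j)) =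
          (\<Oplus>\<^bsub>L\<^esub>l\<in>{..<n}. (f \<circ> (\<lambda>l. A $$ (i, l) \<otimes>\<^bsub>K\<^esub> B $$ (l, j))) l)"
      using ij entry by (subst hom_finsum) (auto simp: comp_def)
    also have "\<dots> = (\<Oplus>\<^bsub>L\<^esub>l\<in>{..<n}. f (A $$ (i, l)) \<otimes>\<^bsub>L\<^esub> f (B $$ (l, j)))"
      using ij entry by (intro L.finsum_cong') auto
    also have "\<dots> = (\<Oplus>\<^bsub>L\<^esub>l\<in>{..<n}. map_mat f A $$ (i, l) \<otimes>\<^bsub>L\<^esub> map_mat f B $$ (l, j))"
      using ij entry dims by (intro L.finsum_cong') auto
    finally show "map_mat f (mat_prod K A B) $$ (i, j) =
        mat_prod L (map_mat f A) (map_mat f B) $$ (i, j)"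
      using ij by (simp add: mat_prod_def dims)
  qed (simp_all add: mat_prod_def)
  show "mat_prod K A B \<in> mats K m p"
  proof (rule matsI)
    fix i j assume ij: "i < m" "j < p"
    have "(\<Oplus>\<^bsub>K\<^esub>l\<in>{..<n}. A $$ (i, l) \<otimes>\<^bsub>K\<^esub> B $$ (l, j)) \<in> carrier K"
      using ij entry by (intro K.finsum_closed) auto
    then show "mat_prod K A B $$ (i, j) \<in> carrier K"
      using ij by (simp add: mat_prod_def dims)
  qed (simp add: mat_prod_def dims)
qed

end

context
  includes cardinal_syntax
begin

lemma card_of_Un_bound:
  assumes "infinite (UNIV :: 'u set)" "|A| \<le>o |UNIV :: 'u set|" "|B| \<le>o |UNIV :: 'u set|"
  shows "|A \<union> B| \<le>o |UNIV :: 'u set|"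
  using assms by (intro card_of_Un_ordLeq_infinite_Field card_of_Card_order) (auto simp: Field_card_of)

lemma card_of_finite_bound:
  assumes "infinite (UNIV :: 'u set)" "finite A"
  shows "|A| \<le>o |UNIV :: 'u set|"
proof -
  obtain B :: "'u set" where "finite B" "card B = card A"
    using infinite_arbitrarily_large[OF assms(1)] by blast
  then obtain g where "bij_betw g A B"
    using finite_same_card_bij assms(2) by metis
  then show ?thesis
    unfolding card_of_ordLeq[symmetric] bij_betw_def by blast
qed

lemma small_subfield:
  fixes L :: "('l, 'c) ring_scheme"
  assumes "field L" "S \<subseteq> carrier L" "infinite (UNIV :: 'u set)" "|S| \<le>o |UNIV :: 'u set|"
  shows "\<exists>F. subfield F L \<and> S \<subseteq> F \<and> |F| \<le>o |UNIV :: 'u set|"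
proof -
  interpret field L by fact
  define step where "step Z = Z \<union> (\<lambda>(x, y). x \<oplus>\<^bsub>L\<^esub> y) ` (Z \<times> Z) \<union> (\<lambda>(x, y). x \<otimes>\<^bsub>L\<^esub> y) ` (Z \<times> Z) \<union>
      (\<lambda>x. \<ominus>\<^bsub>L\<^esub> x) ` Z \<union> (\<lambda>x. inv\<^bsub>L\<^esub> x) ` (Z - {\<zero>\<^bsub>L\<^esub>})" for Z
  define T where "T i = (step ^^ i) (S \<union> {\<one>\<^bsub>L\<^esub>})" for i :: nat
  define F where "F = (\<Union>i. T i)"
  have Suc: "T (Suc i) = step (T i)" for i by (simp add: T_def)
  have "T i \<subseteq> T (Suc i)" for i by (auto simp: Suc step_def)
  then have mono: "i \<le> j \<Longrightarrow> T i \<subseteq> T j" for i j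
    by (rule lift_Suc_mono_le)
  have carr: "T i \<subseteq> carrier L" for i
  proof (induction i)
    case 0
    then show ?case using assms(2) by (auto simp: T_def)
  next
    case (Suc i)
    have "step Z \<subseteq> carrier L" if "Z \<subseteq> carrier L" for Z
      using that field_Units by (auto simp: step_def subset_iff intro!: Units_inv_closed)
    then show ?case using Suc \<open>T (Suc i) = step (T i)\<close> by simp
  qed
  have inF: "\<exists>i. x \<in> T i \<and> y \<in> T i" if "x \<in> F" "y \<in> F" for x y
  proof -
    from that obtain i j where "x \<in> T i" "y \<in> T j" by (auto simp: F_def)
    then show ?thesis using mono[of i "max i j"] mono[of j "max i j"] by auto
  qed
  have stepF: "x \<in> step (T i) \<Longrightarrow> x \<in> F" for x i
    unfolding F_def Suc[symmetric] by blast
  have "subring F L"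
  proof (rule subringI)
    show "F \<subseteq> carrier L" using carr by (auto simp: F_def)
    have "\<one>\<^bsub>L\<^esub> \<in> T 0" by (simp add: T_def)
    then show "\<one>\<^bsub>L\<^esub> \<in> F" by (auto simp: F_def)
    fix x y assume xy: "x \<in> F" "y \<in> F"
    then obtain i where i: "x \<in> T i" "y \<in> T i" using inF by blast
    show "\<ominus>\<^bsub>L\<^esub> x \<in> F" by (rule stepF[of _ i]) (use i in \<open>auto simp: step_def\<close>)
    show "x \<otimes>\<^bsub>L\<^esub> y \<in> F" by (rule stepF[of _ i]) (use i in \<open>auto simp: step_def\<close>)
    show "x \<oplus>\<^bsub>L\<^esub> y \<in> F" by (rule stepF[of _ i]) (use i in \<open>auto simp: step_def\<close>)
  qed
  moreover have "inv\<^bsub>L\<^esub> x \<in> F" if x: "x \<in> F - {\<zero>\<^bsub>L\<^esub>}" for x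
  proof -
    obtain i where i: "x \<in> T i" using x by (auto simp: F_def)
    show ?thesis by (rule stepF[of _ i]) (use i x in \<open>auto simp: step_def\<close>)
  qed
  ultimately have "subfield F L" by (rule subfieldI')
  moreover have "S \<subseteq> F"
    using mono[of 0] by (auto simp: F_def T_def intro!: exI[of _ 0])
  moreover have "|F| \<le>o |UNIV :: 'u set|"
  proof -
    let ?small = "\<lambda>Z. |Z :: 'l set| \<le>o |UNIV :: 'u set|"
    have Un: "?small (A \<union> B)" if "?small A" "?small B" for A B
      using card_of_Un_bound[OF assms(3)] that by blast
    have im: "?small (g ` A)" if "|A| \<le>o |UNIV :: 'u set|" for g and A :: "'x set"
      using card_of_image ordLeq_transitive that by blast
    have fin: "?small A" if "finite A" for A
      using card_of_finite_bound[OF assms(3)] that by blast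
    have "?small (T i)" for i
    proof (induction i)
      case 0
      then show ?case using Un[OF assms(4) fin[of "{\<one>\<^bsub>L\<^esub>}"]] by (simp add: T_def)
    next
      case (Suc i)
      have "|T i \<times> T i| \<le>o |UNIV :: 'u set|"
        using card_of_Times_ordLeq_infinite_Field[of "|UNIV :: 'u set|"] assms(3) Suc
          card_of_Card_order by (metis Field_card_of)
      moreover have "|T i - {\<zero>\<^bsub>L\<^esub>}| \<le>o |UNIV :: 'u set|"
        using Suc card_of_mono1[of "T i - {\<zero>\<^bsub>L\<^esub>}" "T i"] ordLeq_transitive by blast
      ultimately show ?case
        unfolding \<open>T (Suc i) = step (T i)\<close> step_def using Suc by (intro Un im)
    qed
    moreover have "|UNIV :: nat set| \<le>o |UNIV :: 'u set|"
      using assms(3) infinite_iff_card_of_nat by blast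
    ultimately show ?thesis
      unfolding F_def using card_of_UNION_ordLeq_infinite[OF assms(3)] by blast
  qed
  ultimately show ?thesis by blast
qed

theorem representable_overD:
  fixes K :: "('k, 'a) ring_scheme" and L :: "('l, 'c) ring_scheme"
  assumes "field K" and rep: "representable_over K n M L"
  shows "representable K n M"
proof -
  define k where "k = nat (rk M (carrier (ground M)))"
  from rep obtain h G where fL: "field L" and M: "ground M = coord_space K n"
    and h: "h \<in> Ring.ring_hom K L" and G: "G \<in> mats L k n"
    and rank: "\<And>A p Y. A \<in> subspaces K (ground M) \<Longrightarrow> Y \<in> mats K n p \<Longrightarrow> column_space K Y = A \<Longrightarrow>
          rk M A = int (mat_rank L (mat_prod L G (map_mat h Y)))"
    unfolding representable_over_def k_def by blast
  interpret K: field K by fact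
  interpret L: field L by fact
  have inf: "infinite (UNIV :: ('k + nat) set)"
    by (simp add: finite_Plus_UNIV_iff)
  have "|h ` carrier K \<union> elements_mat G| \<le>o |UNIV :: ('k + nat) set|"
  proof -
    have "|carrier K| \<le>o |UNIV :: ('k + nat) set|"
      unfolding card_of_ordLeq[symmetric] by (intro exI[of _ Inl]) auto
    then have "|h ` carrier K| \<le>o |UNIV :: ('k + nat) set|"
      using card_of_image ordLeq_transitive by blast
    moreover have "finite (elements_mat G)"
      unfolding elements_mat_def by auto
    then have "|elements_mat G| \<le>o |UNIV :: ('k + nat) set|"
      by (rule card_of_finite_bound[OF inf])
    ultimately show ?thesis
      using card_of_Un_bound[OF inf] by blast
  qed
  moreover have "h ` carrier K \<union> elements_mat G \<subseteq> carrier L"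
    using h G by (auto simp: Ring.ring_hom_def mats_def)
  ultimately obtain F where F: "subfield F L" "h ` carrier K \<union> elements_mat G \<subseteq> F"
      "|F| \<le>o |UNIV :: ('k + nat) set|"
    using small_subfield[OF fL _ inf] by blast
  obtain g :: "'l \<Rightarrow> 'k + nat" where g: "inj_on g F"
    using F(3) unfolding card_of_ordLeq[symmetric] by blast
  define LF where "LF = L\<lparr>carrier := F\<rparr>"
  define L0 where "L0 = image_ring g LF"
  define f where "f = inv_into F g"
  have FL: "F \<subseteq> carrier L"
    using subfieldE(3)[OF F(1)] .
  interpret LF: field LF
    unfolding LF_def by (rule L.subfield_iff(2)[OF F(1)])
  have g': "inj_on g (carrier LF)" using g by (simp add: LF_def)
  have iso: "g \<in> ring_iso LF L0"
    unfolding L0_def by (rule inj_imp_image_ring_iso[OF g'])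
  have fL0: "field L0"
    unfolding L0_def by (rule LF.inj_imp_image_ring_is_field[OF g'])
  interpret L0: field L0 by (rule fL0)
  have g_hom: "g \<in> Ring.ring_hom LF L0" using iso by (simp add: ring_iso_def)
  have cL0: "carrier L0 = g ` F" by (simp add: L0_def image_ring_carrier LF_def)
  have fg: "f (g x) = x" if "x \<in> F" for x
    using g that by (simp add: f_def)
  have hF: "h x \<in> F" if "x \<in> carrier K" for x
    using F(2) that by blast
  have gs: "g x \<otimes>\<^bsub>L0\<^esub> g y = g (x \<otimes>\<^bsub>L\<^esub> y)" "g x \<oplus>\<^bsub>L0\<^esub> g y = g (x \<oplus>\<^bsub>L\<^esub> y)"
    "x \<otimes>\<^bsub>L\<^esub> y \<in> F" "x \<oplus>\<^bsub>L\<^esub> y \<in> F" if "x \<in> F" "y \<in> F" for x y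
    using that ring_hom_mult[OF g_hom, of x y] ring_hom_add[OF g_hom, of x y]
      LF.m_closed[of x y] LF.a_closed[of x y] by (simp_all add: LF_def)
  have g1: "g \<one>\<^bsub>L\<^esub> = \<one>\<^bsub>L0\<^esub>" "\<one>\<^bsub>L\<^esub> \<in> F"
    using ring_hom_one[OF g_hom] LF.one_closed by (simp_all add: LF_def)
  have f_hom: "f \<in> Ring.ring_hom L0 L"
  proof (rule ring_hom_memI)
    fix x assume "x \<in> carrier L0"
    then show "f x \<in> carrier L" using fg FL by (auto simp: cL0)
  next
    fix x y assume "x \<in> carrier L0" "y \<in> carrier L0"
    then obtain a b where ab: "a \<in> F" "b \<in> F" "x = g a" "y = g b" by (auto simp: cL0)
    show "f (x \<otimes>\<^bsub>L0\<^esub> y) = f x \<otimes>\<^bsub>L\<^esub> f y" "f (x \<oplus>\<^bsub>L0\<^esub> y) = f x \<oplus>\<^bsub>L\<^esub> f y"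
      using ab by (simp_all add: gs fg)
  next
    show "f \<one>\<^bsub>L0\<^esub> = \<one>\<^bsub>L\<^esub>" using g1 fg by metis
  qed
  interpret fe: field_embedding L0 L f
    by unfold_locales (rule f_hom)
  define h0 where "h0 = g \<circ> h"
  define G0 where "G0 = map_mat g G"
  have h0: "h0 \<in> Ring.ring_hom K L0"
  proof (rule ring_hom_memI)
    fix x assume "x \<in> carrier K"
    then show "h0 x \<in> carrier L0" using hF by (auto simp: h0_def cL0)
  next
    fix x y assume "x \<in> carrier K" "y \<in> carrier K"
    then show "h0 (x \<otimes>\<^bsub>K\<^esub> y) = h0 x \<otimes>\<^bsub>L0\<^esub> h0 y" "h0 (x \<oplus>\<^bsub>K\<^esub> y) = h0 x \<oplus>\<^bsub>L0\<^esub> h0 y"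
      using hF by (simp_all add: h0_def gs ring_hom_mult[OF h] ring_hom_add[OF h])
  next
    show "h0 \<one>\<^bsub>K\<^esub> = \<one>\<^bsub>L0\<^esub>" using g1 by (simp add: h0_def ring_hom_one[OF h])
  qed
  have GF: "G $$ (i, j) \<in> F" if "i < k" "j < n" for i j
    using F(2) G elements_matI[of G k n i j] that by (auto simp: mats_def)
  have G0: "G0 \<in> mats L0 k n"
    using GF mats_dims[OF G] by (intro matsI) (auto simp: G0_def cL0)
  have fG0: "map_mat f G0 = G"
    using GF mats_dims[OF G] by (intro eq_matI) (auto simp: G0_def fg)
  have "rk M A = int (mat_rank L0 (mat_prod L0 G0 (map_mat h0 Y)))"
    if A: "A \<in> subspaces K (ground M)" and Y: "Y \<in> mats K n p" "column_space K Y = A" for A p Y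
  proof -
    note dY = mats_dims[OF Y(1)]
    have Y0: "map_mat h0 Y \<in> mats L0 n p"
      using mats_entry[OF Y(1)] ring_hom_closed[OF h0] dY by (intro matsI) auto
    have "map_mat f (map_mat h0 Y) = map_mat h Y"
      using mats_entry[OF Y(1)] hF dY by (intro eq_matI) (auto simp: h0_def fg)
    then have "map_mat f (mat_prod L0 G0 (map_mat h0 Y)) = mat_prod L G (map_mat h Y)"
      using fe.map_mat_prod(1)[OF G0 Y0] fG0 by simp
    then have "mat_rank L (mat_prod L G (map_mat h Y)) = mat_rank L0 (mat_prod L0 G0 (map_mat h0 Y))"
      using fe.mat_rank_map[OF fe.map_mat_prod(2)[OF G0 Y0]] by simp
    then show ?thesis using rank[OF A Y] by simp
  qed
  then have "representable_over K n M L0"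
    unfolding representable_over_def k_def[symmetric] using M fL0 h0 G0 by blast
  then show ?thesis
    unfolding representable_def by blast
qed

end


end

theory Submission
  imports Defs
begin

text \<open>The circuits of dimension 2 are lines of the projective space $PG(3,2)$, that is, subspaces of
  $E$ with four elements; call two of them disjoint if they share no nonzero vector.
  If $M$ is as in the statement, then \<open>E1\<close> and \<open>E2\<close> have rank 1, $E$ has rank 2 and every nonzero
  vector spans a subspace of rank 1. Two rank-one subspaces that share a nonzero vector have a rank-one sum, by submodularity,
  and a rank-one subspace has at most four elements, as otherwise it would meet \<open>E1\<close> and \<open>E2\<close> and
  could be enlarged to all of $E$. Hence the circuits of dimension 2 are the lines of rank 1, and
  they form a partial spread that contains \<open>E1\<close> and \<open>E2\<close> (lemma \<open>circuits_partial_spread\<close>).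

  Suppose that $M$ is represented by a $2\times 4$ matrix $G$ over $L$. Then
  $D(x,y)=\det(Gx \mid Gy)$ is an alternating biadditive form with values in a field of
  characteristic 2, and the line spanned by $x$ and $y$ has rank at most 1 iff $D(x,y)=0$
  (lemma \<open>representable_form\<close>). Four pairwise disjoint lines of $PG(3,2)$ leave three points
  uncovered, and these form a fifth line. The value of $D$ on a line does not depend on the basis, and
  the values of any alternating form in characteristic 2 on the five lines of a spread add up to
  zero: the five Pluecker vectors are linearly dependent over the prime field. So if $D$ vanishes
  on four lines of a spread, it vanishes on the fifth, and four circuits of dimension 2 force a fifth
  one (theorem \<open>not_four_circuits\<close>). In coordinates adapted to the first three lines there are just two
  candidates for the other two (lemma \<open>spread_normal_form\<close>), which makes the argument a
  short calculation (lemma \<open>spread_lines_rank_iff\<close>).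

  Conversely every partial spread is the set of 2-dimensional circuits of some $q$-matroid, in
  which the lines of the partial spread have rank 1 and all other lines and all
  larger subspaces have rank 2 (lemmas \<open>spread_qmatroid\<close> and \<open>spread_circuits\<close>). A
  partial spread of four lines that contains \<open>E1\<close> and \<open>E2\<close> therefore gives a
  $q$-matroid that is not representable.\<close>

section \<open>Vector spaces over the field with two elements\<close>

text \<open>These two simplification rules would rewrite the operations inside the record that \<^term>\<open>F2\<close>
  abbreviates, so that no fact about \<^term>\<open>F2\<close> would match any more.\<close>

declare add_bit_eq_xor [simp del] mult_bit_eq_and [simp del]

locale binary_space = vectorspace F2 V for V :: "(bit, 'v, 'b) module_scheme" (structure) +
  assumes finite_carrier: "finite (carrier V)"
begin

lemma add_self [simp]:
  assumes "x \<in> carrier V"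
  shows "x \<oplus> x = \<zero>"
proof -
  have "x \<oplus> x = (1::bit) \<odot> x \<oplus> (1::bit) \<odot> x"
    using assms smult_one[of x] by simp
  also have "\<dots> = (1 + 1 :: bit) \<odot> x"
    using assms smult_l_distr[of 1 1 x] by simp
  also have "\<dots> = \<zero>"
    using assms lmult_0[of x] by simp
  finally show ?thesis .
qed

lemma add_self_left [simp]:
  "x \<in> carrier V \<Longrightarrow> y \<in> carrier V \<Longrightarrow> x \<oplus> (x \<oplus> y) = y"
  by (simp add: M.a_assoc[symmetric])

lemma smult_bit: "x \<in> carrier V \<Longrightarrow> c \<odot> x = (if c = 0 then \<zero> else x)"
  using smult_one[of x] lmult_0[of x] by (cases c) simp_all

lemma add_eq_iff:
  assumes "x \<in> carrier V" "y \<in> carrier V" "z \<in> carrier V"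
  shows "x \<oplus> y = z \<longleftrightarrow> y = x \<oplus> z"
  using assms by auto

text \<open>Scalars 0 and 1 act trivially, so the subspaces are the additive subgroups; this is the
  form in which they are used below.\<close>

lemma subspaces_iff:
  "A \<in> subspaces F2 V \<longleftrightarrow> A \<subseteq> carrier V \<and> \<zero> \<in> A \<and> (\<forall>x\<in>A. \<forall>y\<in>A. x \<oplus> y \<in> A)"
proof
  assume "A \<in> subspaces F2 V"
  then interpret A: LinearCombinations.submodule F2 A V
    by (simp add: subspaces_def VectorSpace.subspace_def)
  show "A \<subseteq> carrier V \<and> \<zero> \<in> A \<and> (\<forall>x\<in>A. \<forall>y\<in>A. x \<oplus> y \<in> A)"
    using A.subset by simp
next
  assume A: "A \<subseteq> carrier V \<and> \<zero> \<in> A \<and> (\<forall>x\<in>A. \<forall>y\<in>A. x \<oplus> y \<in> A)"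
  then have "c \<odot> x \<in> A" if "x \<in> A" for c x
    using that by (subst smult_bit) auto
  then have "LinearCombinations.submodule F2 A V"
    using A module.module_axioms by (intro LinearCombinations.submodule.intro) auto
  then show "A \<in> subspaces F2 V"
    using vectorspace_axioms by (simp add: subspaces_def VectorSpace.subspace_def)
qed

lemma subspaceD:
  assumes "A \<in> subspaces F2 V"
  shows "A \<subseteq> carrier V" "\<zero> \<in> A" "x \<in> A \<Longrightarrow> y \<in> A \<Longrightarrow> x \<oplus> y \<in> A" "finite A"
  using assms finite_subset[OF _ finite_carrier] by (auto simp: subspaces_iff)

lemma zero_subspace: "{\<zero>} \<in> subspaces F2 V"
  and carrier_subspace: "carrier V \<in> subspaces F2 V"
  by (auto simp: subspaces_iff)

lemma inter_subspace:
  "A \<in> subspaces F2 V \<Longrightarrow> B \<in> subspaces F2 V \<Longrightarrow> A \<inter> B \<in> subspaces F2 V"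
  by (auto simp: subspaces_iff)

lemma binary_subspace:
  assumes "A \<in> subspaces F2 V"
  shows "binary_space (V\<lparr>carrier := A\<rparr>)"
  using assms subspace_is_vs subspaceD[OF assms]
  by (auto simp: binary_space_def binary_space_axioms_def subspaces_def)

lemma restricted_subspaces:
  assumes "A \<in> subspaces F2 V"
  shows "subspaces F2 (V\<lparr>carrier := A\<rparr>) = {B \<in> subspaces F2 V. B \<subseteq> A}"
proof -
  interpret A: binary_space "V\<lparr>carrier := A\<rparr>"
    using assms by (rule binary_subspace)
  show ?thesis
    using subspaceD(1)[OF assms] by (auto simp: A.subspaces_iff subspaces_iff subset_iff)
qed

lemma mem_sum: "x \<in> A <+>\<^bsub>V\<^esub> B \<longleftrightarrow> (\<exists>a\<in>A. \<exists>b\<in>B. x = a \<oplus> b)"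
  by (auto simp: set_add_def')

lemma sum_subspace:
  assumes "A \<in> subspaces F2 V" "B \<in> subspaces F2 V"
  shows "A <+>\<^bsub>V\<^esub> B \<in> subspaces F2 V"
proof -
  note A = subspaceD[OF assms(1)] and B = subspaceD[OF assms(2)]
  have "\<exists>c\<in>A. \<exists>d\<in>B. a \<oplus> b \<oplus> (a' \<oplus> b') = c \<oplus> d"
    if "a \<in> A" "b \<in> B" "a' \<in> A" "b' \<in> B" for a b a' b'
  proof -
    have "a \<oplus> b \<oplus> (a' \<oplus> b') = a \<oplus> a' \<oplus> (b \<oplus> b')"
      using that A(1) B(1) by (simp add: M.a_ac subset_iff)
    then show ?thesis
      using that A(3) B(3) by blast
  qed
  moreover have "\<exists>a\<in>A. \<exists>b\<in>B. \<zero> = a \<oplus> b"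
    using A(2) B(2) M.l_zero[OF M.zero_closed] by metis
  ultimately show ?thesis
    using A(1) B(1) unfolding subspaces_iff by (auto simp: mem_sum subset_iff)
qed

lemma sum_upper:
  assumes "A \<in> subspaces F2 V" "B \<in> subspaces F2 V"
  shows "A \<subseteq> A <+>\<^bsub>V\<^esub> B" "B \<subseteq> A <+>\<^bsub>V\<^esub> B"
proof -
  note A = subspaceD[OF assms(1)] and B = subspaceD[OF assms(2)]
  show "A \<subseteq> A <+>\<^bsub>V\<^esub> B"
    using A(1) B(2) M.r_zero by (force simp: mem_sum)
  show "B \<subseteq> A <+>\<^bsub>V\<^esub> B"
    using A(2) B(1) M.l_zero by (force simp: mem_sum)
qed

lemma direct_sum_inj:
  assumes "A \<in> subspaces F2 V" "B \<in> subspaces F2 V" "A \<inter> B = {\<zero>}"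
  shows "inj_on (\<lambda>(a, b). a \<oplus> b) (A \<times> B)"
proof (rule inj_onI, clarify)
  note A = subspaceD[OF assms(1)] and B = subspaceD[OF assms(2)]
  fix a b a' b'
  assume *: "a \<in> A" "b \<in> B" "a' \<in> A" "b' \<in> B" "a \<oplus> b = a' \<oplus> b'"
  have c: "a \<in> carrier V" "b \<in> carrier V" "a' \<in> carrier V" "b' \<in> carrier V"
    using * A(1) B(1) by auto
  have "a \<oplus> a' \<oplus> (b \<oplus> b') = (a \<oplus> b) \<oplus> (a' \<oplus> b')"
    using c by (simp add: M.a_ac)
  then have "a \<oplus> a' \<oplus> (b \<oplus> b') = \<zero>"
    using c * by simp
  then have "b \<oplus> b' = a \<oplus> a'"
    using c add_eq_iff[of "a \<oplus> a'" "b \<oplus> b'" \<zero>] by simp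
  then have "a \<oplus> a' = \<zero>" "b \<oplus> b' = \<zero>"
    using A(3) B(3) * assms(3) by (metis IntI singletonD)+
  then show "a = a' \<and> b = b'"
    using c add_eq_iff[of a a' \<zero>] add_eq_iff[of b b' \<zero>] by simp
qed

lemma card_direct_sum:
  assumes "A \<in> subspaces F2 V" "B \<in> subspaces F2 V" "A \<inter> B = {\<zero>}"
  shows "card (A <+>\<^bsub>V\<^esub> B) = card A * card B"
proof -
  have "A <+>\<^bsub>V\<^esub> B = (\<lambda>(a, b). a \<oplus> b) ` (A \<times> B)"
    by (auto simp: set_add_def')
  then show ?thesis
    using direct_sum_inj[OF assms] by (simp add: card_image card_cartesian_product)
qed

lemma direct_sum_carrier:
  assumes "A \<in> subspaces F2 V" "B \<in> subspaces F2 V" "A \<inter> B = {\<zero>}"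
    and "card A * card B = card (carrier V)"
  shows "A <+>\<^bsub>V\<^esub> B = carrier V"
  using card_direct_sum[OF assms(1-3)] assms(4) subspaceD(1)[OF sum_subspace[OF assms(1,2)]] finite_carrier
  by (intro card_subset_eq) simp_all

text \<open>Adjoining an independent vector \<open>b\<close> to \<open>B\<close> adds the coset of
  the span of \<open>B\<close> through \<open>b\<close> and thereby doubles the span.\<close>

lemma card_span:
  assumes "finite B" "B \<subseteq> carrier V" "lin_indpt B"
  shows "card (span B) = 2 ^ card B"
  using assms
proof (induction B rule: finite_induct)
  case empty
  have "span {} = {\<zero>}"
    using span_is_subset[of "{}" "{\<zero>}"] zero_subspace span_is_submodule[of "{}"]
    by (auto simp: subspaces_def LinearCombinations.submodule_def)
  then show ?case by simp
next
  case (insert b B)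
  have b: "b \<in> carrier V" "B \<subseteq> carrier V" using insert.prems by auto
  have li: "lin_indpt B" using insert.prems subset_li_is_li[of "insert b B" B] by auto
  have S: "span B \<in> subspaces F2 V" "span (insert b B) \<in> subspaces F2 V"
    using span_is_subspace insert.prems b by (auto simp: subspaces_def)
  note D = subspaceD[OF S(1)] and D' = subspaceD[OF S(2)]
  have bn: "b \<notin> span B"
    using lin_dep_iff_in_span[OF b(2) li b(1)] insert by auto
  let ?T = "span B \<union> (\<lambda>v. b \<oplus> v) ` span B"
  have T: "?T \<in> subspaces F2 V"
  proof -
    have "x \<oplus> (b \<oplus> y) = b \<oplus> (x \<oplus> y)" "(b \<oplus> y) \<oplus> x = b \<oplus> (x \<oplus> y)"
      "(b \<oplus> x) \<oplus> (b \<oplus> y) = x \<oplus> y" if "x \<in> span B" "y \<in> span B" for x y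
      using that b D(1) by (auto simp: M.a_ac subset_iff)
    then show ?thesis
      unfolding subspaces_iff using D(1-3) b by auto
  qed
  have "B \<subseteq> span B" using in_own_span[OF b(2)] .
  moreover have "b \<in> ?T" using D(2) b by (auto intro!: image_eqI[of _ _ \<zero>])
  ultimately have "span (insert b B) \<subseteq> ?T"
    using T by (intro span_is_subset) (auto simp: subspaces_def)
  moreover have "?T \<subseteq> span (insert b B)"
  proof -
    have "insert b B \<subseteq> span (insert b B)"
      using in_own_span insert.prems by blast
    moreover have "span B \<subseteq> span (insert b B)"
      using span_is_monotone by blast
    ultimately show ?thesis using D'(3) by blast
  qed
  ultimately have "span (insert b B) = ?T" by blast
  moreover have "span B \<inter> (\<lambda>v. b \<oplus> v) ` span B = {}"
  proof -
    have "b \<in> span B" if "v \<in> span B" "b \<oplus> v \<in> span B" for v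
    proof -
      have "(b \<oplus> v) \<oplus> v \<in> span B" using that D(3) by blast
      then show ?thesis using that b D(1) by (simp add: M.a_ac subset_iff)
    qed
    then show ?thesis using bn by blast
  qed
  moreover have "card ((\<lambda>v. b \<oplus> v) ` span B) = card (span B)"
    by (intro card_image inj_onI) (use b D(1) in \<open>auto simp: subset_iff\<close>)
  ultimately have "card (span (insert b B)) = card (span B) + card (span B)"
    using D(4) by (simp add: card_Un_disjoint)
  then show ?case using insert li b by simp
qed

lemma card_carrier: "card (carrier V) = 2 ^ dim"
proof -
  have "fin_dim"
    unfolding fin_dim_def using finite_carrier span_is_subset2[of "carrier V"]
      in_own_span[of "carrier V"] by blast
  then obtain B where "finite B" "basis B"
    using finite_basis_exists by blast
  then show ?thesis
    using card_span[of B] dim_basis[of B] by (auto simp: basis_def)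
qed

text \<open>Cardinalities determine dimensions; from here on, dimensions of subspaces are read off
  by counting.\<close>

lemma card_subspace:
  assumes "A \<in> subspaces F2 V"
  shows "card A = 2 ^ sdim F2 V A"
proof -
  interpret A: binary_space "V\<lparr>carrier := A\<rparr>"
    using assms by (rule binary_subspace)
  show ?thesis
    using A.card_carrier by (simp add: sdim_def)
qed

text \<open>For distinct nonzero \<open>x\<close> and \<open>y\<close> this is the 2-dimensional
  subspace they span, a line of the projective space. It is given by its elements because all later
  arguments inspect them.\<close>

definition line :: "'v \<Rightarrow> 'v \<Rightarrow> 'v set" where
  "line x y = {\<zero>, x, y, x \<oplus> y}"

lemma mem_line: "\<zero> \<in> line x y" "x \<in> line x y" "y \<in> line x y" "x \<oplus> y \<in> line x y"
  by (simp_all add: line_def)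

lemma line_subspace:
  assumes "x \<in> carrier V" "y \<in> carrier V"
  shows "line x y \<in> subspaces F2 V"
proof -
  have "x \<oplus> y \<oplus> x = y" "x \<oplus> y \<oplus> y = x" "y \<oplus> x = x \<oplus> y" "y \<oplus> (x \<oplus> y) = x"
    using assms by (simp_all add: M.a_ac)
  then show ?thesis
    using assms by (simp add: subspaces_iff line_def)
qed

lemma sum_eq_iff:
  assumes "x \<in> carrier V" "y \<in> carrier V"
  shows "x \<oplus> y = \<zero> \<longleftrightarrow> x = y" "x \<oplus> y = x \<longleftrightarrow> y = \<zero>" "x \<oplus> y = y \<longleftrightarrow> x = \<zero>"
  using assms by (auto simp: add_eq_iff)

lemma card_line:
  assumes "x \<in> carrier V" "y \<in> carrier V" "x \<noteq> \<zero>" "y \<noteq> \<zero>" "x \<noteq> y"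
  shows "card (line x y) = 4"
  using assms sum_eq_iff[OF assms(1,2)] by (simp add: line_def card_insert_if eq_commute)

lemma line_subset: "A \<in> subspaces F2 V \<Longrightarrow> x \<in> A \<Longrightarrow> y \<in> A \<Longrightarrow> line x y \<subseteq> A"
  by (auto simp: line_def subspaces_iff)

lemma line_eq:
  assumes "A \<in> subspaces F2 V" "card A = 4" "x \<in> A" "y \<in> A" "x \<noteq> \<zero>" "y \<noteq> \<zero>" "x \<noteq> y"
  shows "A = line x y"
proof -
  have "x \<in> carrier V" "y \<in> carrier V"
    using assms subspaceD(1) by blast+
  then show ?thesis
    using card_line[of x y] assms line_subset[OF assms(1,3,4)] subspaceD(4)[OF assms(1)]
    by (metis card_subset_eq)
qed

lemma line_through:
  assumes "A \<in> subspaces F2 V" "card A = 4" "x \<in> A" "x \<noteq> \<zero>"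
  obtains y where "y \<in> A" "y \<noteq> \<zero>" "x \<noteq> y" "A = line x y"
proof -
  have "card {\<zero>, x} \<le> 2" by (simp add: card_insert_if)
  then have "\<not> A \<subseteq> {\<zero>, x}"
    using assms(2) card_mono[of "{\<zero>, x}" A] by auto
  then show ?thesis
    using that line_eq[OF assms(1-3)] assms(4) by blast
qed

lemma nonzero_point:
  assumes "A \<in> subspaces F2 V" "card A > 1"
  obtains x where "x \<in> A" "x \<noteq> \<zero>"
proof -
  have "\<not> A \<subseteq> {\<zero>}"
    using assms(2) card_mono[of "{\<zero>}" A] by auto
  then show ?thesis using that by blast
qed

lemma sdim_iff:
  assumes "A \<in> subspaces F2 V"
  shows "sdim F2 V A = 0 \<longleftrightarrow> card A = 1" "sdim F2 V A = 1 \<longleftrightarrow> card A = 2"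
    "sdim F2 V A = 2 \<longleftrightarrow> card A = 4" "sdim F2 V A \<ge> 2 \<longleftrightarrow> card A \<ge> 4"
proof -
  have "(2::nat) ^ n = 1 \<longleftrightarrow> n = 0" "(2::nat) ^ n = 2 \<longleftrightarrow> n = 1" "(2::nat) ^ n = 4 \<longleftrightarrow> n = 2"
    "4 \<le> (2::nat) ^ n \<longleftrightarrow> 2 \<le> n" for n
    using power_inject_exp[of "2::nat" n 1] power_inject_exp[of "2::nat" n 2]
      power_increasing_iff[of "2::nat" 2 n] by simp_all
  then show "sdim F2 V A = 0 \<longleftrightarrow> card A = 1" "sdim F2 V A = 1 \<longleftrightarrow> card A = 2"
    "sdim F2 V A = 2 \<longleftrightarrow> card A = 4" "sdim F2 V A \<ge> 2 \<longleftrightarrow> card A \<ge> 4"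
    unfolding card_subspace[OF assms] by metis+
qed

lemma zero_subset:
  assumes "A \<in> subspaces F2 V"
  shows "card A = 1 \<longleftrightarrow> A = {\<zero>}"
  using subspaceD(2)[OF assms] by (auto simp: card_1_singleton_iff)

lemma card_2_subspace:
  assumes "A \<in> subspaces F2 V" "x \<in> A" "x \<noteq> \<zero>"
  shows "card A = 2 \<longleftrightarrow> A = {\<zero>, x}"
  using subspaceD(2,4)[OF assms(1)] card_subset_eq[of A "{\<zero>, x}"] assms by auto

lemma point_subspace: "x \<in> carrier V \<Longrightarrow> {\<zero>, x} \<in> subspaces F2 V"
  using line_subspace[of x x] by (simp add: line_def insert_commute)

lemma card_cases:
  assumes "A \<in> subspaces F2 V"
  obtains "card A = 1" | "card A = 2" | "card A \<ge> 4"
  using sdim_iff[OF assms] by (cases "sdim F2 V A = 0"; cases "sdim F2 V A = 1"; force)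

end

section \<open>Minors isomorphic to a uniform $q$-matroid\<close>

lemma coord_binary_space: "binary_space (coord_space F2 n)"
proof -
  have F: "field F2" by (rule class_field)
  have "x \<in> {0, 1}" for x :: bit by (cases x) simp_all
  then have "finite (UNIV :: bit set)"
    by (metis finite.emptyI finite.insertI finite_subset subsetI)
  then show ?thesis
    unfolding binary_space_def binary_space_axioms_def
    using coord_space_vectorspace[OF F] by (auto simp: coord_space_simps[OF F] intro!: finite_PiE)
qed

lemma card_coord_space: "card (carrier (coord_space F2 n)) = 2 ^ n"
  using binary_space.card_carrier[OF coord_binary_space] coord_space_dim(1)[of F2 n] class_field by simp

lemma uniform_simps [simp]:
  "ground (uniform F2 k n) = coord_space F2 n"
  "rk (uniform F2 k n) A = int (min (sdim F2 (coord_space F2 n) A) k)"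
  by (simp_all add: uniform_def)

lemma uniform_1_rank:
  assumes "A \<in> subspaces F2 (coord_space F2 n)"
  shows "rk (uniform F2 1 n) A = (if A = {\<zero>\<^bsub>coord_space F2 n\<^esub>} then 0 else 1)"
proof -
  interpret U: binary_space "coord_space F2 n" by (rule coord_binary_space)
  show ?thesis
    using U.sdim_iff[OF assms] U.zero_subset[OF assms] by (auto simp: min_def)
qed

text \<open>A lattice isomorphism maps the least subspace to the least subspace, and in $U_{1,n}$
  this is the only subspace with rank different from 1.\<close>

lemma uniform_iso_rank:
  assumes "binary_space (ground N)" "isomorphic F2 N (uniform F2 1 n)" "A \<in> subspaces F2 (ground N)"
  shows "rk N A = (if A = {\<zero>\<^bsub>ground N\<^esub>} then 0 else 1)"
proof -
  interpret N: binary_space "ground N" by fact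
  interpret U: binary_space "coord_space F2 n" by (rule coord_binary_space)
  obtain \<phi> where \<phi>: "lattice_iso F2 (ground N) (coord_space F2 n) \<phi>"
    and rk: "\<And>B. B \<in> subspaces F2 (ground N) \<Longrightarrow> rk N B = rk (uniform F2 1 n) (\<phi> B)"
    using assms(2) by (auto simp: isomorphic_def)
  have b: "bij_betw \<phi> (subspaces F2 (ground N)) (subspaces F2 (coord_space F2 n))"
    and I: "\<And>A B. A \<in> subspaces F2 (ground N) \<Longrightarrow> B \<in> subspaces F2 (ground N) \<Longrightarrow> \<phi> (A \<inter> B) = \<phi> A \<inter> \<phi> B"
    using \<phi> by (auto simp: lattice_iso_def)
  have img: "\<phi> B \<in> subspaces F2 (coord_space F2 n)" if "B \<in> subspaces F2 (ground N)" for B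
    using b that by (rule bij_betwE[rule_format])
  have "{\<zero>\<^bsub>coord_space F2 n\<^esub>} \<in> \<phi> ` subspaces F2 (ground N)"
    using bij_betw_imp_surj_on[OF b] U.zero_subspace by simp
  then obtain Z where Z: "{\<zero>\<^bsub>coord_space F2 n\<^esub>} = \<phi> Z" "Z \<in> subspaces F2 (ground N)"
    by (rule imageE)
  have "\<phi> {\<zero>\<^bsub>ground N\<^esub>} = \<phi> ({\<zero>\<^bsub>ground N\<^esub>} \<inter> Z)"
    using N.subspaceD(2)[OF Z(2)] by simp
  also have "\<dots> = {\<zero>\<^bsub>coord_space F2 n\<^esub>}"
    using I[OF N.zero_subspace Z(2)] U.subspaceD(2)[OF img[OF N.zero_subspace]]
    by (auto simp: Z(1)[symmetric])
  finally have "\<phi> A = {\<zero>\<^bsub>coord_space F2 n\<^esub>} \<longleftrightarrow> A = {\<zero>\<^bsub>ground N\<^esub>}"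
    using inj_on_eq_iff[OF bij_betw_imp_inj_on[OF b] assms(3) N.zero_subspace] by simp
  then show ?thesis
    using rk[OF assms(3)] uniform_1_rank[OF img[OF assms(3)]] by simp
qed

lemma additive_bij_lattice_iso:
  assumes "binary_space V" "binary_space W" and bij: "bij_betw f (carrier V) (carrier W)"
    and add: "\<And>x y. x \<in> carrier V \<Longrightarrow> y \<in> carrier V \<Longrightarrow> f (x \<oplus>\<^bsub>V\<^esub> y) = f x \<oplus>\<^bsub>W\<^esub> f y"
  shows "lattice_iso F2 V W ((`) f)"
proof -
  interpret V: binary_space V by fact
  interpret W: binary_space W by fact
  have mem: "f x \<in> carrier W" if "x \<in> carrier V" for x
    using bij that by (rule bij_betwE[rule_format])
  have inj: "inj_on f (carrier V)" using bij by (simp add: bij_betw_def)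
  have zero: "f \<zero>\<^bsub>V\<^esub> = \<zero>\<^bsub>W\<^esub>"
    using add[of "\<zero>\<^bsub>V\<^esub>" "\<zero>\<^bsub>V\<^esub>"] mem[of "\<zero>\<^bsub>V\<^esub>"] by simp
  have "bij_betw ((`) f) (subspaces F2 V) (subspaces F2 W)"
  proof (rule bij_betwI')
    fix A B assume "A \<in> subspaces F2 V" "B \<in> subspaces F2 V"
    then show "f ` A = f ` B \<longleftrightarrow> A = B"
      using V.subspaceD(1) by (intro inj_on_image_eq_iff[OF inj]) auto
  next
    fix A assume "A \<in> subspaces F2 V"
    then show "f ` A \<in> subspaces F2 W"
      unfolding V.subspaces_iff W.subspaces_iff using mem zero
      by (auto simp: subset_iff add[symmetric] intro: image_eqI[OF sym])
  next
    fix B assume B: "B \<in> subspaces F2 W"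
    define A where "A = {x \<in> carrier V. f x \<in> B}"
    have "A \<in> subspaces F2 V"
      using W.subspaceD[OF B] zero add by (auto simp: A_def V.subspaces_iff)
    moreover have "B = f ` A"
      using W.subspaceD(1)[OF B] bij by (auto simp: A_def bij_betw_def)
    ultimately show "\<exists>A\<in>subspaces F2 V. B = f ` A" by blast
  qed
  moreover have "f ` (A \<inter> B) = f ` A \<inter> f ` B" if "A \<in> subspaces F2 V" "B \<in> subspaces F2 V" for A B
    using inj_on_image_Int[OF inj] that V.subspaceD(1) by blast
  moreover have "f ` (A <+>\<^bsub>V\<^esub> B) = f ` A <+>\<^bsub>W\<^esub> f ` B" if "A \<in> subspaces F2 V" "B \<in> subspaces F2 V" for A B
  proof -
    have "f (a \<oplus>\<^bsub>V\<^esub> b) = f a \<oplus>\<^bsub>W\<^esub> f b" if "a \<in> A" "b \<in> B" for a b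
      using that add \<open>A \<in> _\<close> \<open>B \<in> _\<close> V.subspaceD(1) by blast
    then show ?thesis
      by (force simp: set_add_def')
  qed
  ultimately show ?thesis
    by (simp add: lattice_iso_def)
qed

text \<open>Any bijection between two Klein four-groups that fixes zero is additive: the sum of two
  distinct nonzero elements is the third one. So a bijection of the ground spaces already yields an
  isomorphism of $q$-matroids.\<close>

lemma uniform_isoI:
  assumes "binary_space (ground N)" "card (carrier (ground N)) = 4"
    and rk: "\<And>A. A \<in> subspaces F2 (ground N) \<Longrightarrow> rk N A = (if A = {\<zero>\<^bsub>ground N\<^esub>} then 0 else 1)"
  shows "isomorphic F2 N (uniform F2 1 2)"
proof -
  let ?V = "ground N" and ?U = "coord_space F2 2"
  interpret V: binary_space ?V by fact
  interpret U: binary_space ?U by (rule coord_binary_space)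
  have cU: "card (carrier ?U) = 4" by (simp add: card_coord_space)
  then have "card (carrier ?V - {\<zero>\<^bsub>?V\<^esub>}) = card (carrier ?U - {\<zero>\<^bsub>?U\<^esub>})"
    using assms(2) by (simp add: card_Diff_singleton)
  then obtain g where "bij_betw g (carrier ?V - {\<zero>\<^bsub>?V\<^esub>}) (carrier ?U - {\<zero>\<^bsub>?U\<^esub>})"
    using V.finite_carrier U.finite_carrier by (metis finite_Diff finite_same_card_bij)
  moreover define f where "f x = (if x = \<zero>\<^bsub>?V\<^esub> then \<zero>\<^bsub>?U\<^esub> else g x)" for x
  ultimately have f1: "bij_betw f (carrier ?V - {\<zero>\<^bsub>?V\<^esub>}) (carrier ?U - {\<zero>\<^bsub>?U\<^esub>})"
    by (subst bij_betw_cong[of _ _ g]) auto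
  have "bij_betw f ({\<zero>\<^bsub>?V\<^esub>} \<union> (carrier ?V - {\<zero>\<^bsub>?V\<^esub>})) ({\<zero>\<^bsub>?U\<^esub>} \<union> (carrier ?U - {\<zero>\<^bsub>?U\<^esub>}))"
    by (intro bij_betw_combine f1) (auto simp: f_def bij_betw_def)
  then have bij: "bij_betw f (carrier ?V) (carrier ?U)"
    by (simp add: insert_absorb)
  have inj: "inj_on f (carrier ?V)" using bij by (simp add: bij_betw_def)
  have mem: "f x \<in> carrier ?U" if "x \<in> carrier ?V" for x
    using bij that by (rule bij_betwE[rule_format])
  have z: "f \<zero>\<^bsub>?V\<^esub> = \<zero>\<^bsub>?U\<^esub>" by (simp add: f_def)
  have eq: "f x = f y \<longleftrightarrow> x = y" if "x \<in> carrier ?V" "y \<in> carrier ?V" for x y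
    using inj that by (rule inj_on_eq_iff)
  have add: "f (x \<oplus>\<^bsub>?V\<^esub> y) = f x \<oplus>\<^bsub>?U\<^esub> f y" if xy: "x \<in> carrier ?V" "y \<in> carrier ?V" for x y
  proof -
    consider "x = \<zero>\<^bsub>?V\<^esub>" | "y = \<zero>\<^bsub>?V\<^esub>" | "x = y" | "x \<noteq> \<zero>\<^bsub>?V\<^esub>" "y \<noteq> \<zero>\<^bsub>?V\<^esub>" "x \<noteq> y" by blast
    then show ?thesis
    proof cases
      case 4
      then have ne: "f x \<noteq> \<zero>\<^bsub>?U\<^esub>" "f y \<noteq> \<zero>\<^bsub>?U\<^esub>" "f x \<noteq> f y"
        using eq[OF xy] eq[OF xy(1) V.M.zero_closed] eq[OF xy(2) V.M.zero_closed] z by simp_all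
      have "carrier ?U = U.line (f x) (f y)"
        using U.line_eq[OF U.carrier_subspace cU mem[OF xy(1)] mem[OF xy(2)] ne] .
      then have "f (x \<oplus>\<^bsub>?V\<^esub> y) \<in> U.line (f x) (f y)"
        using mem xy by blast
      moreover have "f (x \<oplus>\<^bsub>?V\<^esub> y) \<noteq> \<zero>\<^bsub>?U\<^esub>" "f (x \<oplus>\<^bsub>?V\<^esub> y) \<noteq> f x" "f (x \<oplus>\<^bsub>?V\<^esub> y) \<noteq> f y"
        using 4(1,2,3) unfolding z[symmetric] eq[OF V.M.a_closed[OF xy] V.M.zero_closed]
          eq[OF V.M.a_closed[OF xy] xy(1)] eq[OF V.M.a_closed[OF xy] xy(2)] V.sum_eq_iff[OF xy] by blast+
      ultimately show ?thesis by (simp add: U.line_def)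
    qed (use xy mem z in simp_all)
  qed
  have iso: "lattice_iso F2 ?V ?U ((`) f)"
    by (intro additive_bij_lattice_iso V.binary_space_axioms U.binary_space_axioms bij add)
  have "rk N A = rk (uniform F2 1 2) (f ` A)" if A: "A \<in> subspaces F2 ?V" for A
  proof -
    have "f ` A \<in> subspaces F2 ?U"
      using iso A by (auto simp: lattice_iso_def bij_betw_def)
    moreover have "f ` A = {\<zero>\<^bsub>?U\<^esub>} \<longleftrightarrow> A = {\<zero>\<^bsub>?V\<^esub>}"
      using inj_on_image_eq_iff[OF inj, of A "{\<zero>\<^bsub>?V\<^esub>}"] V.subspaceD(1)[OF A] z by simp
    ultimately show ?thesis
      using rk[OF A] uniform_1_rank by simp
  qed
  then show ?thesis
    unfolding isomorphic_def using iso by auto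
qed

context binary_space
begin

lemma quotient_simps:
  "carrier (quot_space V W) = a_rcosets\<^bsub>V\<^esub> W" "\<zero>\<^bsub>quot_space V W\<^esub> = W"
  by (simp_all add: quot_space_def)

lemma subspace_subgroup:
  assumes "W \<in> subspaces F2 V"
  shows "subgroup W (add_monoid V)"
proof -
  have "\<ominus> x = x" if "x \<in> W" for x
    using that subspaceD(1)[OF assms] by (intro M.minus_equality) auto
  then show ?thesis
    using subspaceD[OF assms] by (intro M.add.subgroupI) (auto simp: a_inv_def[symmetric])
qed

lemma quotient_binary_space:
  assumes "W \<in> subspaces F2 V"
  shows "binary_space (quot_space V W)"
proof -
  have "carrier (quot_space V W) \<subseteq> Pow (carrier V)"
    using subspaceD(1)[OF assms] by (auto simp: quotient_simps A_RCOSETS_def' a_r_coset_def' )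
  then have "finite (carrier (quot_space V W))"
    using finite_carrier by (meson finite_Pow_iff finite_subset)
  then show ?thesis
    using quot_space_vectorspace assms
    by (auto simp: binary_space_def binary_space_axioms_def subspaces_def)
qed

lemma card_quotient:
  assumes "W \<in> subspaces F2 V"
  shows "card (carrier (quot_space V W)) * card W = card (carrier V)"
  using M.add.lagrange[OF subspace_subgroup[OF assms]]
  by (simp add: quotient_simps A_RCOSETS_def Coset.order_def)

lemma Union_quotient:
  assumes "W \<in> subspaces F2 V"
  shows "\<Union> (carrier (quot_space V W)) = carrier V"
  using M.add.rcosets_part_G[OF subspace_subgroup[OF assms]]
  by (simp add: quotient_simps A_RCOSETS_def)

text \<open>A nonzero subspace of the quotient contains a coset other than \<open>W\<close>, and
  this is disjoint from \<open>W\<close>.\<close>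

lemma Union_quotient_subspace:
  assumes W: "W \<in> subspaces F2 V" and C: "C \<in> subspaces F2 (quot_space V W)" "C \<noteq> {W}"
  shows "W \<subset> \<Union> C"
proof -
  interpret Q: binary_space "quot_space V W"
    using W by (rule quotient_binary_space)
  \<comment> \<open>The coset \<open>W\<close> is the zero of the quotient.\<close>
  have "W \<in> C" using Q.subspaceD(2)[OF C(1)] by (simp add: quotient_simps)
  then obtain D where D: "D \<in> C" "D \<noteq> W" using C(2) by blast
  have "D \<in> rcosets\<^bsub>add_monoid V\<^esub> W" "W \<in> rcosets\<^bsub>add_monoid V\<^esub> W"
    using Q.subspaceD(1)[OF C(1)] D \<open>W \<in> C\<close> by (auto simp: quotient_simps A_RCOSETS_def)
  then have "D \<inter> W = {}"
    using M.add.rcos_disjoint[OF subspace_subgroup[OF W]] D(2) by (auto simp: pairwise_def disjnt_def)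
  moreover have "D \<noteq> {}"
    using \<open>D \<in> rcosets\<^bsub>add_monoid V\<^esub> W\<close> subspaceD(2)[OF W] by (auto simp: RCOSETS_def r_coset_def)
  ultimately show ?thesis using \<open>W \<in> C\<close> D(1) by blast
qed

end

lemma ground_restriction_contraction [simp]:
  "ground (restriction M W) = (ground M)\<lparr>carrier := W\<rparr>" "rk (restriction M W) = rk M"
  "ground (contraction M W) = quot_space (ground M) W" "rk (contraction M W) C = rk M (\<Union>C) - rk M W"
  by (simp_all add: restriction_def contraction_def)

lemma restriction_uniform_rank:
  assumes V: "binary_space (ground M)" and W: "W \<in> subspaces F2 (ground M)"
    and iso: "isomorphic F2 (restriction M W) (uniform F2 1 n)"
    and A: "A \<in> subspaces F2 (ground M)" "A \<subseteq> W"
  shows "rk M A = (if A = {\<zero>\<^bsub>ground M\<^esub>} then 0 else 1)"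
proof -
  interpret binary_space "ground M" by fact
  show ?thesis
    using uniform_iso_rank[OF _ iso, of A] A restricted_subspaces[OF W] binary_subspace[OF W] by simp
qed

lemma contraction_uniform_rank:
  assumes V: "binary_space (ground M)" and W: "W \<in> subspaces F2 (ground M)" "W \<noteq> carrier (ground M)"
    and iso: "isomorphic F2 (contraction M W) (uniform F2 1 n)"
  shows "rk M (carrier (ground M)) = rk M W + 1"
proof -
  interpret binary_space "ground M" by fact
  interpret Q: binary_space "quot_space (ground M) W"
    using W(1) by (rule quotient_binary_space)
  have "carrier (quot_space (ground M) W) \<noteq> {W}"
    using Union_quotient[OF W(1)] W(2) by auto
  then show ?thesis
    using uniform_iso_rank[OF _ iso, of "carrier (quot_space (ground M) W)"]
      Q.binary_space_axioms Q.carrier_subspace Union_quotient[OF W(1)] by (simp add: quotient_simps(2))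
qed

section \<open>The $q$-matroid of a partial spread\<close>

text \<open>Without loops, all subspaces of dimension at most 1 are independent, so the only
  condition for a 2-dimensional subspace to be a circuit is that it is dependent.\<close>

lemma two_dim_circuits:
  fixes M :: "(bit, 'v) qmat"
  assumes "binary_space (ground M)" and zero: "rk M {\<zero>\<^bsub>ground M\<^esub>} = 0"
    and point: "\<And>x. x \<in> carrier (ground M) \<Longrightarrow> x \<noteq> \<zero>\<^bsub>ground M\<^esub> \<Longrightarrow> rk M {\<zero>\<^bsub>ground M\<^esub>, x} = 1"
  shows "circuits_of_dim F2 M 2 = {A \<in> subspaces F2 (ground M). card A = 4 \<and> rk M A \<noteq> 2}"
proof -
  interpret binary_space "ground M" by fact
  have small: "indep F2 M B" if B: "B \<in> subspaces F2 (ground M)" "card B < 4" for B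
  proof -
    consider "card B = 1" | "card B = 2" using card_cases[OF B(1)] B(2) by force
    then show ?thesis
    proof cases
      case 1
      then show ?thesis
        using B zero sdim_iff[OF B(1)] zero_subset[OF B(1)] by (simp add: indep_def)
    next
      case 2
      then obtain x where x: "x \<in> B" "x \<noteq> \<zero>\<^bsub>ground M\<^esub>" using nonzero_point[OF B(1)] by auto
      then show ?thesis
        using B 2 point[of x] subspaceD(1)[OF B(1)] sdim_iff[OF B(1)] card_2_subspace[OF B(1) x]
        by (auto simp: indep_def)
    qed
  qed
  show ?thesis
  proof (intro equalityI subsetI)
    fix A assume "A \<in> circuits_of_dim F2 M 2"
    then show "A \<in> {A \<in> subspaces F2 (ground M). card A = 4 \<and> rk M A \<noteq> 2}"
      by (auto simp: circuits_of_dim_def circuits_def indep_def sdim_iff(3))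
  next
    fix A assume A: "A \<in> {A \<in> subspaces F2 (ground M). card A = 4 \<and> rk M A \<noteq> 2}"
    then have "card B < 4" if "B \<subset> A" for B
      using psubset_card_mono[OF subspaceD(4) that] by simp
    then show "A \<in> circuits_of_dim F2 M 2"
      using A small by (auto simp: circuits_of_dim_def circuits_def sdim_iff(3)) (simp add: indep_def sdim_iff(3))
  qed
qed

definition partial_spread :: "(bit, 'v, 'b) module_scheme \<Rightarrow> 'v set set \<Rightarrow> bool" where
  "partial_spread V S \<longleftrightarrow> S \<subseteq> subspaces F2 V \<and> (\<forall>A\<in>S. card A = 4) \<and>
     (\<forall>A\<in>S. \<forall>B\<in>S. A \<noteq> B \<longrightarrow> A \<inter> B = {\<zero>\<^bsub>V\<^esub>})"

text \<open>The dimension is replaced by the cardinality, so that the rank function needs no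
  reference to the ambient space.\<close>

definition spread_rank :: "'v set set \<Rightarrow> 'v set \<Rightarrow> int" where
  "spread_rank S A = (if card A = 1 then 0 else if card A = 2 \<or> A \<in> S then 1 else 2)"

definition spread_qmat :: "(bit, 'v) module \<Rightarrow> 'v set set \<Rightarrow> (bit, 'v) qmat" where
  "spread_qmat V S = \<lparr>ground = V, rk = spread_rank S\<rparr>"

lemma spread_qmat_simps [simp]:
  "ground (spread_qmat V S) = V" "rk (spread_qmat V S) = spread_rank S"
  by (simp_all add: spread_qmat_def)

lemma spread_rank_bounds: "0 \<le> spread_rank S A" "spread_rank S A \<le> 2"
  by (simp_all add: spread_rank_def)

context
  fixes V :: "(bit, 'v) module" and S
  assumes V: "binary_space V" and S: "partial_spread V S"
begin

interpretation binary_space V by (rule V)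

lemma spread_rank_0: "A \<in> subspaces F2 V \<Longrightarrow> spread_rank S A = 0 \<longleftrightarrow> A = {\<zero>\<^bsub>V\<^esub>}"
  by (simp add: spread_rank_def flip: zero_subset)

lemma spread_rank_le_1:
  "A \<in> subspaces F2 V \<Longrightarrow> spread_rank S A \<le> 1 \<longleftrightarrow> card A \<le> 2 \<or> A \<in> S"
  by (erule card_cases) (simp_all add: spread_rank_def)

lemma spread_rank_mono_1:
  assumes "A \<in> subspaces F2 V" "B \<in> subspaces F2 V" "A \<subseteq> B" "spread_rank S B \<le> 1"
  shows "spread_rank S A \<le> 1"
proof (cases "card A \<le> 2")
  case False
  then have "card A \<ge> 4" using card_cases[OF assms(1)] by force
  moreover have "card A \<le> card B" using assms(3) subspaceD(4)[OF assms(2)] by (rule card_mono[rotated])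
  ultimately have "B \<in> S" using assms(4) spread_rank_le_1[OF assms(2)] by auto
  then have "card A = card B" using \<open>card A \<ge> 4\<close> \<open>card A \<le> card B\<close> S by (simp add: partial_spread_def)
  then have "A = B" using assms(3) subspaceD(4)[OF assms(2)] by (simp add: card_subset_eq)
  then show ?thesis using assms by simp
qed (use spread_rank_le_1[OF assms(1)] in simp)

text \<open>This is where disjointness of the lines enters, and it is the crux of submodularity: the
  only pairs of rank-one subspaces with sum of rank 2 intersect in a subspace of rank 0.\<close>

lemma meeting_rank_one_comparable:
  assumes A: "A \<in> subspaces F2 V" "spread_rank S A \<le> 1"
    and B: "B \<in> subspaces F2 V" "spread_rank S B \<le> 1"
    and x: "x \<in> A \<inter> B" "x \<noteq> \<zero>\<^bsub>V\<^esub>"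
  shows "A \<subseteq> B \<or> B \<subseteq> A"
proof -
  have pt: "C = {\<zero>\<^bsub>V\<^esub>, x}" if "C \<in> subspaces F2 V" "card C \<le> 2" "x \<in> C" for C
    using that(1)
  proof (cases rule: card_cases)
    case 1
    then show ?thesis using that(3) x(2) zero_subset[OF that(1)] by auto
  qed (use that card_2_subspace[OF that(1,3) x(2)] in auto)
  have "A = B" if "A \<in> S" "B \<in> S"
    using that S x unfolding partial_spread_def by blast
  then show ?thesis
    using A(2) B(2) x spread_rank_le_1[OF A(1)] spread_rank_le_1[OF B(1)] pt[OF A(1)] pt[OF B(1)]
      subspaceD(2)[OF A(1)] subspaceD(2)[OF B(1)] by auto
qed

lemma spread_qmatroid: "qmatroid F2 (spread_qmat V S)"
proof -
  have bound: "spread_rank S A \<le> int (sdim F2 V A)" if "A \<in> subspaces F2 V" for A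
    using that
  proof (cases rule: card_cases)
    case 3
    then show ?thesis
      using sdim_iff(4)[OF that] spread_rank_bounds(2)[of S A] by linarith
  qed (use sdim_iff[OF that] in \<open>simp_all add: spread_rank_def\<close>)
  have mono: "spread_rank S A \<le> spread_rank S B"
    if "A \<in> subspaces F2 V" "B \<in> subspaces F2 V" "A \<subseteq> B" for A B
  proof -
    have "spread_rank S A = 0" if "spread_rank S B = 0"
      using that spread_rank_0[OF \<open>A \<in> _\<close>] spread_rank_0[OF \<open>B \<in> _\<close>] \<open>A \<subseteq> B\<close>
        subspaceD(2)[OF \<open>A \<in> _\<close>] by auto
    then show ?thesis
      using spread_rank_mono_1[OF that] spread_rank_bounds[of S A] spread_rank_bounds[of S B] by linarith
  qed
  have sub: "spread_rank S (A <+>\<^bsub>V\<^esub> B) + spread_rank S (A \<inter> B) \<le> spread_rank S A + spread_rank S B"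
    if A: "A \<in> subspaces F2 V" and B: "B \<in> subspaces F2 V" for A B
  proof (cases "A \<subseteq> B \<or> B \<subseteq> A")
    case True
    have "A <+>\<^bsub>V\<^esub> B = B" if "A \<subseteq> B"
      using that subspaceD[OF B] sum_upper[OF A B] by (auto simp: mem_sum subset_iff)
    moreover have "A <+>\<^bsub>V\<^esub> B = A" if "B \<subseteq> A"
      using that subspaceD[OF A] sum_upper[OF A B] by (auto simp: mem_sum subset_iff)
    ultimately show ?thesis
      using True by (auto simp: Int_absorb1 Int_absorb2)
  next
    case False
    have I: "A \<inter> B \<in> subspaces F2 V" using A B by (rule inter_subspace)
    have "spread_rank S A \<noteq> 0" "spread_rank S B \<noteq> 0"
      using False spread_rank_0[OF A] spread_rank_0[OF B] subspaceD(2)[OF A] subspaceD(2)[OF B] by auto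
    then have pos: "spread_rank S A \<ge> 1" "spread_rank S B \<ge> 1"
      using spread_rank_bounds(1)[of S A] spread_rank_bounds(1)[of S B] by linarith+
    have le: "spread_rank S (A \<inter> B) \<le> spread_rank S A" "spread_rank S (A \<inter> B) \<le> spread_rank S B"
      using mono[OF I A] mono[OF I B] by auto
    show ?thesis
    proof (cases "spread_rank S A \<le> 1 \<and> spread_rank S B \<le> 1")
      case True
      then have "A \<inter> B \<subseteq> {\<zero>\<^bsub>V\<^esub>}"
        using meeting_rank_one_comparable[OF A _ B] False by blast
      then have "spread_rank S (A \<inter> B) = 0"
        using spread_rank_0[OF I] subspaceD(2)[OF I] by auto
      then show ?thesis
        using pos spread_rank_bounds(2)[of S "A <+>\<^bsub>V\<^esub> B"] by linarith
    next
      case F: False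
      then show ?thesis
        using pos le spread_rank_bounds(2)[of S A] spread_rank_bounds(2)[of S B]
          spread_rank_bounds(2)[of S "A <+>\<^bsub>V\<^esub> B"] by linarith
    qed
  qed
  have "fin_dim"
    unfolding fin_dim_def using finite_carrier span_is_subset2[of "carrier V"]
      in_own_span[of "carrier V"] by blast
  then show ?thesis
    unfolding qmatroid_def using bound mono sub vectorspace_axioms by (simp add: spread_rank_bounds(1))
qed

lemma spread_circuits: "circuits_of_dim F2 (spread_qmat V S) 2 = S"
proof -
  have "spread_rank S {\<zero>\<^bsub>V\<^esub>} = 0" by (simp add: spread_rank_def)
  moreover have "spread_rank S {\<zero>\<^bsub>V\<^esub>, x} = 1" if "x \<noteq> \<zero>\<^bsub>V\<^esub>" for x
    using that by (simp add: spread_rank_def eq_commute)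
  ultimately show ?thesis
    using two_dim_circuits[of "spread_qmat V S"] V S
    by (auto simp: partial_spread_def spread_rank_def split: if_splits)
qed

end

lemma spread_restriction:
  assumes V: "binary_space V" and S: "partial_spread V S" "W \<in> S"
  shows "isomorphic F2 (restriction (spread_qmat V S) W) (uniform F2 1 2)"
proof -
  interpret binary_space V by fact
  have W: "W \<in> subspaces F2 V" "card W = 4"
    using S by (auto simp: partial_spread_def)
  show ?thesis
  proof (rule uniform_isoI)
    fix A assume "A \<in> subspaces F2 (ground (restriction (spread_qmat V S) W))"
    then have A: "A \<in> subspaces F2 V" "A \<subseteq> W"
      using restricted_subspaces[OF W(1)] by simp_all
    have "spread_rank S W = 1" using S(2) W(2) by (simp add: spread_rank_def)
    then have "spread_rank S A \<le> 1"
      using spread_rank_mono_1[OF V S(1) A(1) W(1) A(2)] by simp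
    then show "rk (restriction (spread_qmat V S) W) A =
        (if A = {\<zero>\<^bsub>ground (restriction (spread_qmat V S) W)\<^esub>} then 0 else 1)"
      using spread_rank_0[OF V S(1) A(1)] spread_rank_bounds(1)[of S A]
      by (cases "A = {\<zero>\<^bsub>V\<^esub>}") simp_all
  qed (use W binary_subspace in simp_all)
qed

text \<open>A nonzero subspace of the quotient by \<open>W\<close> corresponds to a subspace with
  more than four elements, which has rank 2.\<close>

lemma spread_contraction:
  assumes V: "binary_space V" "card (carrier V) = 16" and S: "partial_spread V S" "W \<in> S"
  shows "isomorphic F2 (contraction (spread_qmat V S) W) (uniform F2 1 2)"
proof -
  interpret binary_space V by fact
  have W: "W \<in> subspaces F2 V" "card W = 4"
    using S by (auto simp: partial_spread_def)
  interpret Q: binary_space "quot_space V W"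
    using W(1) by (rule quotient_binary_space)
  have rW: "spread_rank S W = 1" using S(2) W(2) by (simp add: spread_rank_def)
  show ?thesis
  proof (rule uniform_isoI)
    show "card (carrier (ground (contraction (spread_qmat V S) W))) = 4"
      using card_quotient[OF W(1)] W(2) V(2) by simp
    fix C assume "C \<in> subspaces F2 (ground (contraction (spread_qmat V S) W))"
    then have C: "C \<in> subspaces F2 (quot_space V W)" by simp
    have "spread_rank S (\<Union>C) = 2" if "C \<noteq> {W}"
    proof -
      have "\<Union>C \<subseteq> \<Union>(carrier (quot_space V W))"
        using Q.subspaceD(1)[OF C] by blast
      then have "finite (\<Union>C)"
        using Union_quotient[OF W(1)] finite_carrier finite_subset by auto
      then have "card (\<Union>C) > 4"
        using psubset_card_mono[of "\<Union>C" W] Union_quotient_subspace[OF W(1) C that] W(2) by simp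
      then show ?thesis
        using S(1) by (auto simp: spread_rank_def partial_spread_def)
    qed
    then show "rk (contraction (spread_qmat V S) W) C =
        (if C = {\<zero>\<^bsub>ground (contraction (spread_qmat V S) W)\<^esub>} then 0 else 1)"
      using rW by (simp add: quotient_simps(2))
  qed (use Q.binary_space_axioms in simp)
qed

section \<open>Two-dimensional circuits form a partial spread\<close>

text \<open>The information contained in the assumptions on the minors: \<open>E1\<close> and
  \<open>E2\<close> are loopless of rank 1, and the whole space has rank 2.\<close>

locale split_qmatroid =
  fixes M :: "(bit, 'v) qmat" and V :: "(bit, 'v) module" (structure) and E1 E2
  assumes qmatroid: "qmatroid F2 M" and ground: "ground M = V"
    and binary: "binary_space V" and card_V: "card (carrier V) = 16"
    and E1: "E1 \<in> subspaces F2 V" "card E1 = 4" and E2: "E2 \<in> subspaces F2 V" "card E2 = 4"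
    and disjoint: "E1 \<inter> E2 = {\<zero>}"
    and rank_E1: "\<And>A. A \<in> subspaces F2 V \<Longrightarrow> A \<subseteq> E1 \<Longrightarrow> A \<noteq> {\<zero>} \<Longrightarrow> rk M A = 1"
    and rank_E2: "\<And>A. A \<in> subspaces F2 V \<Longrightarrow> A \<subseteq> E2 \<Longrightarrow> A \<noteq> {\<zero>} \<Longrightarrow> rk M A = 1"
    and rank_V: "rk M (carrier V) = 2"
begin

sublocale binary_space V by (rule binary)

lemma rank_nonneg: "A \<in> subspaces F2 V \<Longrightarrow> 0 \<le> rk M A"
  and rank_le_dim: "A \<in> subspaces F2 V \<Longrightarrow> rk M A \<le> int (sdim F2 V A)"
  and rank_mono: "A \<in> subspaces F2 V \<Longrightarrow> B \<in> subspaces F2 V \<Longrightarrow> A \<subseteq> B \<Longrightarrow> rk M A \<le> rk M B"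
  and rank_submodular: "A \<in> subspaces F2 V \<Longrightarrow> B \<in> subspaces F2 V \<Longrightarrow>
    rk M (A <+>\<^bsub>V\<^esub> B) + rk M (A \<inter> B) \<le> rk M A + rk M B"
  using qmatroid unfolding qmatroid_def ground by blast+

lemma E_sum: "E1 <+>\<^bsub>V\<^esub> E2 = carrier V"
  using direct_sum_carrier[OF E1(1) E2(1) disjoint] E1(2) E2(2) card_V by simp

text \<open>A subspace with more than four elements of a 16-element space meets every line
  nontrivially. Adding to a rank-one subspace \<open>T\<close> of this size first \<open>E1\<close>
  and then \<open>E2\<close> therefore never raises the rank, although the result is the whole
  space.\<close>

lemma rank_one_card:
  assumes T: "T \<in> subspaces F2 V" "rk M T \<le> 1"
  shows "card T \<le> 4"
proof (rule ccontr)
  assume large: "\<not> card T \<le> 4"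
  have meets: "B \<inter> E \<noteq> {\<zero>}"
    if B: "B \<in> subspaces F2 V" "card B > 4" and E: "E \<in> subspaces F2 V" "card E = 4" for B E
  proof
    assume "B \<inter> E = {\<zero>}"
    then have "card B * 4 = card (B <+>\<^bsub>V\<^esub> E)"
      using card_direct_sum[OF B(1) E(1)] E(2) by simp
    also have "\<dots> \<le> 16"
      unfolding card_V[symmetric]
      by (intro card_mono finite_carrier subspaceD(1) sum_subspace B E)
    finally show False using B(2) by simp
  qed
  have 1: "T <+>\<^bsub>V\<^esub> E1 \<in> subspaces F2 V"
    using T(1) E1(1) by (rule sum_subspace)
  have "rk M (T \<inter> E1) = 1"
    using meets[OF T(1) _ E1] large by (intro rank_E1 inter_subspace T E1) auto
  moreover have "E1 \<noteq> {\<zero>}" "E2 \<noteq> {\<zero>}" using E1(2) E2(2) by auto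
  ultimately have r: "rk M (T <+>\<^bsub>V\<^esub> E1) \<le> 1"
    using rank_submodular[OF T(1) E1(1)] T(2) rank_E1[OF E1(1)] by simp
  have "card T \<le> card (T <+>\<^bsub>V\<^esub> E1)"
    using sum_upper(1)[OF T(1) E1(1)] subspaceD(4)[OF 1] by (intro card_mono)
  then have "rk M ((T <+>\<^bsub>V\<^esub> E1) \<inter> E2) = 1"
    using meets[OF 1 _ E2] large by (intro rank_E2 inter_subspace 1 E2) auto
  then have "rk M ((T <+>\<^bsub>V\<^esub> E1) <+>\<^bsub>V\<^esub> E2) \<le> 1"
    using rank_submodular[OF 1 E2(1)] r rank_E2[OF E2(1)] \<open>E2 \<noteq> {\<zero>}\<close> by simp
  moreover have "(T <+>\<^bsub>V\<^esub> E1) <+>\<^bsub>V\<^esub> E2 = carrier V"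
  proof
    show "(T <+>\<^bsub>V\<^esub> E1) <+>\<^bsub>V\<^esub> E2 \<subseteq> carrier V"
      by (intro subspaceD(1) sum_subspace T E1 E2)
    show "carrier V \<subseteq> (T <+>\<^bsub>V\<^esub> E1) <+>\<^bsub>V\<^esub> E2"
      unfolding E_sum[symmetric] using sum_upper(2)[OF T(1) E1(1)] by (force simp: mem_sum)
  qed
  ultimately show False using rank_V by simp
qed

lemma rank_zero: "rk M {\<zero>} = 0"
  using rank_nonneg[OF zero_subspace] rank_le_dim[OF zero_subspace] sdim_iff(1)[OF zero_subspace] by simp

text \<open>A loop \<open>x\<close> would lie outside \<open>E1\<close>, so \<open>E1\<close> and
  \<open>x\<close> would span a rank-one subspace with eight elements.\<close>

lemma rank_point:
  assumes x: "x \<in> carrier V" "x \<noteq> \<zero>"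
  shows "rk M {\<zero>, x} = 1"
proof -
  note X = point_subspace[OF x(1)]
  have "E1 \<noteq> {\<zero>}" using E1(2) by auto
  have "rk M {\<zero>, x} \<noteq> 0"
  proof
    assume 0: "rk M {\<zero>, x} = 0"
    have "x \<notin> E1"
      using rank_E1[OF X] 0 x subspaceD(2)[OF E1(1)] by auto
    then have "{\<zero>, x} \<inter> E1 = {\<zero>}" using subspaceD(2)[OF E1(1)] by auto
    then have "{\<zero>, x} \<inter> E1 = {\<zero>}" "card {\<zero>, x} = 2"
      using x(2) by simp_all
    then have "card ({\<zero>, x} <+>\<^bsub>V\<^esub> E1) = 8"
      using card_direct_sum[OF X E1(1)] E1(2) by simp
    moreover have "rk M ({\<zero>, x} <+>\<^bsub>V\<^esub> E1) \<le> 1"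
      using rank_submodular[OF X E1(1)] 0 rank_E1[OF E1(1)] \<open>E1 \<noteq> {\<zero>}\<close> rank_nonneg[OF inter_subspace[OF X E1(1)]]
      by simp
    ultimately show False
      using rank_one_card[OF sum_subspace[OF X E1(1)]] by simp
  qed
  moreover have "sdim F2 V {\<zero>, x} = 1"
    using sdim_iff(2)[OF X] x(2) by simp
  ultimately show ?thesis
    using rank_nonneg[OF X] rank_le_dim[OF X] by simp
qed

lemma rank_pos:
  assumes "A \<in> subspaces F2 V" "x \<in> A" "x \<noteq> \<zero>"
  shows "1 \<le> rk M A"
proof -
  have "x \<in> carrier V" using assms subspaceD(1) by blast
  then show ?thesis
    using rank_mono[OF point_subspace assms(1), of x] rank_point[of x] subspaceD(2)[OF assms(1)] assms by simp
qed

lemma circuits_eq: "circuits_of_dim F2 M 2 = {A \<in> subspaces F2 V. card A = 4 \<and> rk M A \<le> 1}"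
proof -
  have "circuits_of_dim F2 M 2 = {A \<in> subspaces F2 V. card A = 4 \<and> rk M A \<noteq> 2}"
    using two_dim_circuits[of M] binary rank_zero rank_point unfolding ground by simp
  moreover have "rk M A \<noteq> 2 \<longleftrightarrow> rk M A \<le> 1" if "A \<in> subspaces F2 V" "card A = 4" for A
    using rank_le_dim[OF that(1)] sdim_iff(3)[OF that(1)] that(2) by auto
  ultimately show ?thesis by auto
qed

text \<open>Two lines of rank 1 with a common nonzero vector have a rank-one sum, which has at most
  four elements and hence equals both of them.\<close>

lemma circuits_partial_spread: "partial_spread V (circuits_of_dim F2 M 2)"
proof -
  have "A = B" if A: "A \<in> subspaces F2 V" "card A = 4" "rk M A \<le> 1"
    and B: "B \<in> subspaces F2 V" "card B = 4" "rk M B \<le> 1" and x: "x \<in> A \<inter> B" "x \<noteq> \<zero>" for A B x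
  proof -
    note S = sum_subspace[OF A(1) B(1)]
    have "rk M (A <+>\<^bsub>V\<^esub> B) \<le> 1"
      using rank_submodular[OF A(1) B(1)] rank_pos[OF inter_subspace[OF A(1) B(1)] x] A(3) B(3) by simp
    then have "card (A <+>\<^bsub>V\<^esub> B) \<le> 4" using rank_one_card[OF S] by simp
    then have "A = A <+>\<^bsub>V\<^esub> B" "B = A <+>\<^bsub>V\<^esub> B"
      using sum_upper[OF A(1) B(1)] subspaceD(4)[OF S] A(2) B(2) card_seteq by metis+
    then show ?thesis by simp
  qed
  then show ?thesis
    unfolding partial_spread_def circuits_eq using subspaceD(2) by blast
qed

lemma E_circuits: "E1 \<in> circuits_of_dim F2 M 2" "E2 \<in> circuits_of_dim F2 M 2"
proof -
  have "E1 \<noteq> {\<zero>}" "E2 \<noteq> {\<zero>}" using E1(2) E2(2) by auto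
  then show "E1 \<in> circuits_of_dim F2 M 2" "E2 \<in> circuits_of_dim F2 M 2"
    using rank_E1[OF E1(1)] rank_E2[OF E2(1)] E1 E2 by (auto simp: circuits_eq)
qed

end

section \<open>The alternating form of a representation\<close>

context vectorspace
begin

lemma mem_span_singleton:
  assumes "v \<in> carrier V"
  shows "w \<in> span {v} \<longleftrightarrow> (\<exists>a\<in>carrier K. w = a \<odot>\<^bsub>V\<^esub> v)"
proof
  assume "w \<in> span {v}"
  then obtain a where "a \<in> {v} \<rightarrow> carrier K" "lincomb a {v} = w"
    using finite_in_span[of "{v}" w] assms by auto
  then show "\<exists>a\<in>carrier K. w = a \<odot>\<^bsub>V\<^esub> v"
    using assms by (auto simp: lincomb_def)
next
  assume "\<exists>a\<in>carrier K. w = a \<odot>\<^bsub>V\<^esub> v"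
  moreover have "v \<in> span {v}"
    using in_own_span[of "{v}"] assms by simp
  moreover have "LinearCombinations.submodule K (span {v}) V"
    using span_is_submodule[of "{v}"] assms by simp
  ultimately show "w \<in> span {v}"
    by (auto simp: LinearCombinations.submodule_def)
qed

lemma lin_indpt_singleton:
  assumes "v \<in> carrier V" "v \<noteq> \<zero>\<^bsub>V\<^esub>"
  shows "lin_indpt {v}"
proof -
  have "span {} = {\<zero>\<^bsub>V\<^esub>}"
    by (auto simp: span_def lincomb_def)
  moreover have "lin_indpt {}"
    by (simp add: lin_dep_def)
  ultimately show ?thesis
    using lin_dep_iff_in_span[of "{}" v] assms by simp
qed

lemma lin_dep_pair_iff:
  assumes "v \<in> carrier V" "w \<in> carrier V" "v \<noteq> w"
  shows "lin_dep {v, w} \<longleftrightarrow> v = \<zero>\<^bsub>V\<^esub> \<or> (\<exists>a\<in>carrier K. w = a \<odot>\<^bsub>V\<^esub> v)"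
proof (cases "v = \<zero>\<^bsub>V\<^esub>")
  case True
  then show ?thesis
    using vs_zero_lin_dep[of "{v, w}"] assms by auto
next
  case False
  then show ?thesis
    using lin_dep_iff_in_span[of "{v}" w] lin_indpt_singleton[of v] mem_span_singleton[of v w] assms
    by (simp add: insert_commute)
qed

lemma dim_span_pair_le_1:
  assumes "v \<in> carrier V" "w \<in> carrier V"
  shows "vectorspace.dim K (span_vs {v, w}) \<le> 1 \<longleftrightarrow>
    v = \<zero>\<^bsub>V\<^esub> \<or> (\<exists>a\<in>carrier K. w = a \<odot>\<^bsub>V\<^esub> v)" (is "?dim \<le> 1 \<longleftrightarrow> ?rel")
proof -
  let ?C = "{v, w}"
  obtain B where B: "maximal B (\<lambda>T. T \<subseteq> ?C \<and> lin_indpt T)"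
    using maximal_exists_superset[of ?C "\<lambda>T. T \<subseteq> ?C \<and> lin_indpt T" "{}"]
    unfolding lin_dep_def by blast
  then have B': "B \<subseteq> ?C" "lin_indpt B"
    unfolding maximal_def by blast+
  have dim: "?dim = card B"
    using dim_span[OF _ _ B] assms by simp
  show ?thesis
  proof (cases "v = w")
    case True
    then have "card B \<le> 1"
      using card_mono[OF _ B'(1)] by simp
    moreover have "w = \<one>\<^bsub>K\<^esub> \<odot>\<^bsub>V\<^esub> v"
      using True assms by simp
    ultimately show ?thesis
      using dim one_closed by auto
  next
    case False
    have "card B \<le> 1 \<longleftrightarrow> B \<noteq> ?C"
    proof
      assume "B \<noteq> ?C"
      then have "B \<subset> ?C" using B'(1) by blast
      then have "card B < card ?C" by (intro psubset_card_mono) simp_all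
      then show "card B \<le> 1" using False by simp
    qed (use False in auto)
    moreover have "B \<noteq> ?C \<longleftrightarrow> lin_dep ?C"
      using B B'(2) unfolding maximal_def by blast
    ultimately show ?thesis
      using dim lin_dep_pair_iff[OF assms False] by simp
  qed
qed

end

lemma (in field) det_eq_iff_proportional:
  assumes "a \<in> carrier R" "b \<in> carrier R" "c \<in> carrier R" "d \<in> carrier R"
  shows "a \<otimes> d = b \<otimes> c \<longleftrightarrow> (a = \<zero> \<and> b = \<zero>) \<or> (\<exists>x\<in>carrier R. c = x \<otimes> a \<and> d = x \<otimes> b)"
proof
  assume eq: "a \<otimes> d = b \<otimes> c"
  have cancel: "u \<otimes> (inv v \<otimes> v) = u" if "u \<in> carrier R" "v \<in> carrier R" "v \<noteq> \<zero>" for u v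
    using that field_Units by simp
  show "(a = \<zero> \<and> b = \<zero>) \<or> (\<exists>x\<in>carrier R. c = x \<otimes> a \<and> d = x \<otimes> b)"
  proof (cases "a = \<zero>")
    case False
    then have i: "inv a \<in> carrier R" using assms field_Units by simp
    have "c = (c \<otimes> inv a) \<otimes> a"
      using cancel[of c a] False i assms by (simp add: m_assoc)
    moreover have "d = (c \<otimes> inv a) \<otimes> b"
    proof -
      have "(c \<otimes> inv a) \<otimes> b = (b \<otimes> c) \<otimes> inv a"
        using assms i by (simp add: m_ac)
      also have "\<dots> = d \<otimes> (inv a \<otimes> a)"
        unfolding eq[symmetric] using assms i by (simp add: m_ac)
      finally show ?thesis using cancel[of d a] False assms by simp
    qed
    ultimately show ?thesis using assms i by blast
  next
    case a: True
    show ?thesis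
    proof (cases "b = \<zero>")
      case False
      then have i: "inv b \<in> carrier R" using assms field_Units by simp
      have "b \<otimes> c = \<zero>" using eq a assms by simp
      then have "c = \<zero>" using False assms integral by blast
      moreover have "d = (d \<otimes> inv b) \<otimes> b"
        using cancel[of d b] False i assms by (simp add: m_assoc)
      ultimately have "c = (d \<otimes> inv b) \<otimes> a \<and> d = (d \<otimes> inv b) \<otimes> b"
        using a i assms by simp
      then show ?thesis using assms i by blast
    qed (use a in simp)
  qed
next
  assume "(a = \<zero> \<and> b = \<zero>) \<or> (\<exists>x\<in>carrier R. c = x \<otimes> a \<and> d = x \<otimes> b)"
  then show "a \<otimes> d = b \<otimes> c"
    using assms by (auto simp: m_ac)
qed

text \<open>The criterion that the determinant vanishes, for matrices over a field that is given by
  its carrier.\<close>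

lemma mat_rank_le_1_iff_det:
  fixes L (structure)
  assumes "field L" and N: "N \<in> mats L 2 2"
  shows "mat_rank L N \<le> 1 \<longleftrightarrow> N $$ (0, 0) \<otimes> N $$ (1, 1) = N $$ (1, 0) \<otimes> N $$ (0, 1)"
proof -
  interpret L: field L by fact
  interpret U: vectorspace L "coord_space L 2"
    using assms(1) by (rule coord_space_vectorspace)
  define c where "c j = (\<lambda>i\<in>{..<2}. N $$ (i, j))" for j
  have e: "N $$ (i, j) \<in> carrier L" if "i < 2" "j < 2" for i j
    using mats_entry[OF N] that .
  have c: "c j \<in> carrier (coord_space L 2)" if "j < 2" for j
    unfolding c_def using e that by (intro coord_space_memI assms(1)) simp
  have all2: "(\<forall>i<2. P i) \<longleftrightarrow> P 0 \<and> P 1" for P :: "nat \<Rightarrow> bool"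
    by (auto simp: numeral_2_eq_2 less_Suc_eq)
  have "{..<2} = {0, 1::nat}" by auto
  then have cols: "mat_cols N = {c 0, c 1}"
    using mats_dims[OF N] by (simp add: mat_cols_def c_def)
  have restrict_eq: "(\<lambda>i\<in>{..<2}. f i) = (\<lambda>i\<in>{..<2}. g i) \<longleftrightarrow> f 0 = g 0 \<and> f 1 = g 1"
    for f g :: "nat \<Rightarrow> 'a"
    unfolding restrict_def fun_eq_iff all2[of "\<lambda>i. f i = g i", symmetric] by (auto simp del: One_nat_def)
  have "mat_rank L N \<le> 1 \<longleftrightarrow>
      c 0 = \<zero>\<^bsub>coord_space L 2\<^esub> \<or> (\<exists>x\<in>carrier L. c 1 = x \<odot>\<^bsub>coord_space L 2\<^esub> c 0)"
    unfolding mat_rank_def column_space_def sdim_def mats_dims[OF N] cols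
    by (intro U.dim_span_pair_le_1 c) simp_all
  also have "\<dots> \<longleftrightarrow> (N $$ (0, 0) = \<zero> \<and> N $$ (1, 0) = \<zero>) \<or>
      (\<exists>x\<in>carrier L. N $$ (0, 1) = x \<otimes> N $$ (0, 0) \<and> N $$ (1, 1) = x \<otimes> N $$ (1, 0))"
    unfolding c_def coord_space_simps[OF assms(1)] restrict_eq by simp
  also have "\<dots> \<longleftrightarrow> N $$ (0, 0) \<otimes> N $$ (1, 1) = N $$ (1, 0) \<otimes> N $$ (0, 1)"
    using e by (subst L.det_eq_iff_proportional) simp_all
  finally show ?thesis .
qed

lemma span_pair_binary:
  assumes "binary_space V" "x \<in> carrier V" "y \<in> carrier V"
  shows "LinearCombinations.module.span F2 V {x, y} = binary_space.line V x y"
proof -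
  interpret binary_space V by fact
  show ?thesis
  proof
    show "span {x, y} \<subseteq> line x y"
      using line_subspace[OF assms(2,3)]
      by (intro span_is_subset) (auto simp: subspaces_def mem_line)
    show "line x y \<subseteq> span {x, y}"
      using span_is_subspace[of "{x, y}"] in_own_span[of "{x, y}"] assms(2,3)
      by (intro line_subset) (auto simp: subspaces_def)
  qed
qed

text \<open>What the argument uses of a representation: an alternating form \<open>D\<close> on the
  ground space that vanishes exactly on the pairs that span a subspace of rank at most 1. Symmetry
  is the form that antisymmetry takes in characteristic 2.\<close>

locale alternating_rank_form = L: field L
  for M :: "(bit, 'v) qmat" and L :: "('l, 'c) ring_scheme" and D :: "'v \<Rightarrow> 'v \<Rightarrow> 'l" +
  assumes char_2: "\<one>\<^bsub>L\<^esub> \<oplus>\<^bsub>L\<^esub> \<one>\<^bsub>L\<^esub> = \<zero>\<^bsub>L\<^esub>"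
    and form_closed: "\<And>x y. x \<in> carrier (ground M) \<Longrightarrow> y \<in> carrier (ground M) \<Longrightarrow> D x y \<in> carrier L"
    and alternating: "\<And>x. x \<in> carrier (ground M) \<Longrightarrow> D x x = \<zero>\<^bsub>L\<^esub>"
    and form_add: "\<And>x y z. x \<in> carrier (ground M) \<Longrightarrow> y \<in> carrier (ground M) \<Longrightarrow> z \<in> carrier (ground M) \<Longrightarrow>
      D (x \<oplus>\<^bsub>ground M\<^esub> y) z = D x z \<oplus>\<^bsub>L\<^esub> D y z"
    and symmetric: "\<And>x y. x \<in> carrier (ground M) \<Longrightarrow> y \<in> carrier (ground M) \<Longrightarrow> D x y = D y x"
    and form_zero_iff: "\<And>x y. x \<in> carrier (ground M) \<Longrightarrow> y \<in> carrier (ground M) \<Longrightarrow>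
      D x y = \<zero>\<^bsub>L\<^esub> \<longleftrightarrow> rk M (binary_space.line (ground M) x y) \<le> 1"
begin

lemma double [simp]: "a \<in> carrier L \<Longrightarrow> a \<oplus>\<^bsub>L\<^esub> a = \<zero>\<^bsub>L\<^esub>"
  using L.l_distr[of "\<one>\<^bsub>L\<^esub>" "\<one>\<^bsub>L\<^esub>" a] char_2 by simp

lemma double_left [simp]: "a \<in> carrier L \<Longrightarrow> b \<in> carrier L \<Longrightarrow> a \<oplus>\<^bsub>L\<^esub> (a \<oplus>\<^bsub>L\<^esub> b) = b"
  by (simp add: L.a_assoc[symmetric])

end

text \<open>The form is the determinant of the two columns $Gx$ and $Gy$ of length \<open>2 = rk M
  (carrier (ground M))\<close>; it is additive since the embedding of \<^term>\<open>F2\<close> into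
  \<open>L\<close> is. In characteristic 2 the determinant is the sum of the two products.\<close>

lemma representable_form:
  assumes rep: "representable F2 n M" and rank: "rk M (carrier (ground M)) = 2"
  obtains L :: "(bit + nat) ring" and D where "alternating_rank_form M L D"
proof -
  obtain L :: "(bit + nat) ring" and h G where
    ground: "ground M = coord_space F2 n" and L: "field L" and h: "h \<in> Ring.ring_hom F2 L"
    and G: "G \<in> mats L 2 n"
    and R: "\<And>A p Y. A \<in> subspaces F2 (ground M) \<Longrightarrow> Y \<in> mats F2 n p \<Longrightarrow> column_space F2 Y = A \<Longrightarrow>
      rk M A = int (mat_rank L (mat_prod L G (map_mat h Y)))"
    using rep rank unfolding representable_def representable_over_def by auto
  let ?V = "coord_space F2 n"
  interpret L: field L by (rule L)
  interpret binary_space ?V by (rule coord_binary_space)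
  have F: "field F2" by (rule class_field)
  interpret field_embedding F2 L h
    by (intro field_embedding.intro F L field_embedding_axioms.intro h)
  have two: "\<one>\<^bsub>L\<^esub> \<oplus>\<^bsub>L\<^esub> \<one>\<^bsub>L\<^esub> = \<zero>\<^bsub>L\<^esub>"
    using f_simps(3)[of 1 1] f_simps(4,5) by simp
  have dbl: "a \<oplus>\<^bsub>L\<^esub> a = \<zero>\<^bsub>L\<^esub>" if "a \<in> carrier L" for a
    using L.l_distr[of "\<one>\<^bsub>L\<^esub>" "\<one>\<^bsub>L\<^esub>" a] that two by simp
  have hc: "h b \<in> carrier L" for b using f_simps(1)[of b] by simp
  have Gc: "G $$ (i, l) \<in> carrier L" if "i < 2" "l < n" for i l
    using mats_entry[OF G] that .
  define g where "g i x = (\<Oplus>\<^bsub>L\<^esub>l\<in>{..<n}. G $$ (i, l) \<otimes>\<^bsub>L\<^esub> h (x l))" for i x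
  have gc: "g i x \<in> carrier L" if "i < 2" for i x
    unfolding g_def using that Gc hc by (intro L.finsum_closed) auto
  have g_add: "g i (x \<oplus>\<^bsub>?V\<^esub> y) = g i x \<oplus>\<^bsub>L\<^esub> g i y" if "i < 2" for i x y
  proof -
    have "g i (x \<oplus>\<^bsub>?V\<^esub> y) = (\<Oplus>\<^bsub>L\<^esub>l\<in>{..<n}. G $$ (i, l) \<otimes>\<^bsub>L\<^esub> h (x l) \<oplus>\<^bsub>L\<^esub> G $$ (i, l) \<otimes>\<^bsub>L\<^esub> h (y l))"
      unfolding g_def
    proof (rule L.finsum_cong')
      fix l assume "l \<in> {..<n}"
      then show "G $$ (i, l) \<otimes>\<^bsub>L\<^esub> h ((x \<oplus>\<^bsub>?V\<^esub> y) l) =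
          G $$ (i, l) \<otimes>\<^bsub>L\<^esub> h (x l) \<oplus>\<^bsub>L\<^esub> G $$ (i, l) \<otimes>\<^bsub>L\<^esub> h (y l)"
        using Gc[OF that] hc f_simps(3)[of "x l" "y l"]
        by (simp add: coord_space_simps(3)[OF F] L.r_distr)
    qed (use Gc[OF that] hc in auto)
    also have "\<dots> = g i x \<oplus>\<^bsub>L\<^esub> g i y"
      unfolding g_def using Gc[OF that] hc by (intro L.finsum_addf) auto
    finally show ?thesis .
  qed
  define D where "D x y = g 0 x \<otimes>\<^bsub>L\<^esub> g 1 y \<oplus>\<^bsub>L\<^esub> g 1 x \<otimes>\<^bsub>L\<^esub> g 0 y" for x y
  note c = gc[of 0, simplified] gc[of 1, simplified]
  show thesis
  proof (rule that[of L D], intro alternating_rank_form.intro L alternating_rank_form_axioms.intro)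
    show "\<one>\<^bsub>L\<^esub> \<oplus>\<^bsub>L\<^esub> \<one>\<^bsub>L\<^esub> = \<zero>\<^bsub>L\<^esub>" by (rule two)
    fix x y assume "x \<in> carrier (ground M)" "y \<in> carrier (ground M)"
    then have xy: "x \<in> carrier ?V" "y \<in> carrier ?V" by (simp_all add: ground)
    show "D x y \<in> carrier L" using c by (simp add: D_def)
    show "D x y = D y x" using c by (simp add: D_def L.a_comm L.m_comm)
    define Y where "Y = mat n 2 (\<lambda>(i, j). if j = 0 then x i else y i)"
    have Y: "Y \<in> mats F2 n 2"
      by (rule matsI) (simp_all add: Y_def)
    have ext: "(\<lambda>i\<in>{..<n}. v i) = v" if "v \<in> carrier ?V" for v
      using that by (auto simp: coord_space_simps(1)[OF F] PiE_def extensional_restrict)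
    have "{..<2} = {0, 1::nat}" by auto
    moreover have "(\<lambda>i\<in>{..<n}. Y $$ (i, 0)) = x" "(\<lambda>i\<in>{..<n}. Y $$ (i, 1)) = y"
      using ext[OF xy(1)] ext[OF xy(2)] by (auto simp: Y_def cong: restrict_cong)
    ultimately have "mat_cols Y = {x, y}"
      by (simp add: mat_cols_def mats_dims[OF Y])
    then have colY: "column_space F2 Y = line x y"
      unfolding column_space_def mats_dims[OF Y]
      using span_pair_binary[OF coord_binary_space xy] by simp
    have hY: "map_mat h Y \<in> mats L n 2"
      using hc by (intro matsI) (simp_all add: Y_def)
    let ?N = "mat_prod L G (map_mat h Y)"
    have entry: "?N $$ (i, j) = g i (if j = 0 then x else y)" if "i < 2" "j < 2" for i j
    proof -
      have "?N $$ (i, j) = (\<Oplus>\<^bsub>L\<^esub>l\<in>{..<n}. G $$ (i, l) \<otimes>\<^bsub>L\<^esub> map_mat h Y $$ (l, j))"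
        using that mats_dims[OF G] mats_dims[OF hY] by (simp add: mat_prod_def)
      also have "\<dots> = g i (if j = 0 then x else y)"
        unfolding g_def using that Gc[OF that(1)] hc by (intro L.finsum_cong') (auto simp: Y_def)
      finally show ?thesis .
    qed
    have N: "?N \<in> mats L 2 2"
    proof (rule matsI)
      show "?N \<in> carrier_mat 2 2"
        using mats_dims[OF G] mats_dims[OF hY] by (simp add: mat_prod_def)
    qed (use entry gc in simp)
    have "rk M (line x y) \<le> 1 \<longleftrightarrow> g 0 x \<otimes>\<^bsub>L\<^esub> g 1 y = g 1 x \<otimes>\<^bsub>L\<^esub> g 0 y"
      using R[OF _ Y colY] line_subspace[OF xy] mat_rank_le_1_iff_det[OF L N] entry
      by (simp add: ground)
    also have "\<dots> \<longleftrightarrow> D x y = \<zero>\<^bsub>L\<^esub>"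
    proof -
      have "a = b" if "a \<oplus>\<^bsub>L\<^esub> b = \<zero>\<^bsub>L\<^esub>" "a \<in> carrier L" "b \<in> carrier L" for a b
        using L.minus_equality[OF that(1,3,2)] L.minus_equality[OF dbl[OF that(3)] that(3,3)] by simp
      from this[of "g 0 x \<otimes>\<^bsub>L\<^esub> g 1 y" "g 1 x \<otimes>\<^bsub>L\<^esub> g 0 y"] show ?thesis
        using c dbl by (auto simp: D_def)
    qed
    finally show "D x y = \<zero>\<^bsub>L\<^esub> \<longleftrightarrow> rk M (binary_space.line (ground M) x y) \<le> 1"
      by (simp add: ground)
  next
    fix x assume "x \<in> carrier (ground M)"
    show "D x x = \<zero>\<^bsub>L\<^esub>" using c dbl by (simp add: D_def L.m_comm)
  next
    fix x y z assume "x \<in> carrier (ground M)" "y \<in> carrier (ground M)" "z \<in> carrier (ground M)"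
    show "D (x \<oplus>\<^bsub>ground M\<^esub> y) z = D x z \<oplus>\<^bsub>L\<^esub> D y z"
      using c g_add by (simp add: D_def ground L.l_distr L.a_ac)
  qed
qed

section \<open>Four lines of a spread determine the fifth\<close>

context binary_space
begin

lemma add_add_swap:
  assumes "a \<in> carrier V" "b \<in> carrier V" "c \<in> carrier V" "d \<in> carrier V"
  shows "(a \<oplus> b) \<oplus> (c \<oplus> d) = (a \<oplus> c) \<oplus> (b \<oplus> d)"
  using assms by (simp add: M.a_ac)

text \<open>A line \<open>C\<close> that meets \<open>E2\<close> trivially is a complement of
  \<open>E2\<close>. Together with \<open>graph_unique\<close> this says that \<open>C\<close> is
  the graph of a map from any complement of \<open>E2\<close> to \<open>E2\<close>.\<close>

lemma graph_point:
  assumes V: "card (carrier V) = 16" and E2: "E2 \<in> subspaces F2 V" "card E2 = 4"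
    and C: "C \<in> subspaces F2 V" "card C = 4" "C \<inter> E2 = {\<zero>}" and a: "a \<in> carrier V"
  obtains b where "b \<in> E2" "a \<oplus> b \<in> C"
proof -
  have "a \<in> C <+>\<^bsub>V\<^esub> E2"
    using direct_sum_carrier[OF C(1) E2(1) C(3)] E2(2) C(2) V a by simp
  then obtain c b where cb: "c \<in> C" "b \<in> E2" "a = c \<oplus> b"
    by (auto simp: mem_sum)
  moreover have "c \<in> carrier V" "b \<in> carrier V"
    using cb C(1) E2(1) subspaceD(1) by blast+
  ultimately have "a \<oplus> b = c"
    by (simp add: M.a_ac)
  then show thesis using that cb by blast
qed

lemma graph_unique:
  assumes "C \<in> subspaces F2 V" "E2 \<in> subspaces F2 V" "C \<inter> E2 = {\<zero>}" "a \<in> carrier V"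
    and "b \<in> E2" "b' \<in> E2" "a \<oplus> b \<in> C" "a \<oplus> b' \<in> C"
  shows "b = b'"
proof -
  have c: "b \<in> carrier V" "b' \<in> carrier V"
    using assms subspaceD(1) by blast+
  have "(a \<oplus> b) \<oplus> (a \<oplus> b') = b \<oplus> b'"
    using c assms(4) add_add_swap[of a b a b'] by simp
  then have "b \<oplus> b' \<in> C \<inter> E2"
    using subspaceD(3)[OF assms(1,7,8)] subspaceD(3)[OF assms(2,5,6)] by simp
  then show ?thesis
    using assms(3) sum_eq_iff(1)[OF c] by simp
qed

text \<open>The definitions \<open>spread_line_4\<close> and \<open>spread_line_5\<close> complete a
  spread: if \<open>E1\<close>, \<open>E2\<close> and the line through \<open>e1 \<oplus> f1\<close>
  and \<open>e2 \<oplus> f2\<close> belong to a spread, then the two remaining lines are the graphs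
  of the two fixed-point-free linear maps that permute \<open>f1\<close>, \<open>f2\<close>,
  \<open>f1 \<oplus> f2\<close> cyclically, once \<open>e1\<close>, \<open>e2\<close> are identified
  with \<open>f1\<close>, \<open>f2\<close>.\<close>

definition spread_line_4 :: "'v \<Rightarrow> 'v \<Rightarrow> 'v \<Rightarrow> 'v \<Rightarrow> 'v set" where
  "spread_line_4 e1 e2 f1 f2 = line (e1 \<oplus> f2) (e2 \<oplus> (f1 \<oplus> f2))"

definition spread_line_5 :: "'v \<Rightarrow> 'v \<Rightarrow> 'v \<Rightarrow> 'v \<Rightarrow> 'v set" where
  "spread_line_5 e1 e2 f1 f2 = line (e1 \<oplus> (f1 \<oplus> f2)) (e2 \<oplus> f1)"

text \<open>Regard \<open>C3\<close> and \<open>C4\<close> as graphs of bijections from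
  \<open>E1\<close> to \<open>E2\<close>, and choose the basis of \<open>E2\<close> as the image of
  a basis of \<open>E1\<close> under the first. Since \<open>C3\<close> and \<open>C4\<close> are
  disjoint, the two bijections differ at each of the three nonzero points, so they differ by a
  cyclic permutation.\<close>

lemma spread_normal_form:
  assumes V: "card (carrier V) = 16" and S: "partial_spread V {E1, E2, C3, C4}"
    and ne: "E1 \<noteq> E2" "C3 \<noteq> E1" "C3 \<noteq> E2" "C4 \<noteq> E1" "C4 \<noteq> E2" "C4 \<noteq> C3"
  obtains e1 e2 f1 f2 where "E1 = line e1 e2" "E2 = line f1 f2" "C3 = line (e1 \<oplus> f1) (e2 \<oplus> f2)"
    "e1 \<noteq> \<zero>" "e2 \<noteq> \<zero>" "e1 \<noteq> e2" "f1 \<noteq> \<zero>" "f2 \<noteq> \<zero>" "f1 \<noteq> f2"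
    "e1 \<in> E1" "e2 \<in> E1" "f1 \<in> E2" "f2 \<in> E2"
    "C4 = spread_line_4 e1 e2 f1 f2 \<or> C4 = spread_line_5 e1 e2 f1 f2"
proof -
  have E1: "E1 \<in> subspaces F2 V" "card E1 = 4" and E2: "E2 \<in> subspaces F2 V" "card E2 = 4"
    and C3: "C3 \<in> subspaces F2 V" "card C3 = 4" and C4: "C4 \<in> subspaces F2 V" "card C4 = 4"
    using S unfolding partial_spread_def by blast+
  have disj: "A \<inter> B = {\<zero>}" if "A \<in> {E1, E2, C3, C4}" "B \<in> {E1, E2, C3, C4}" "A \<noteq> B" for A B
    using S that unfolding partial_spread_def by blast
  have D: "E1 \<inter> E2 = {\<zero>}" "C3 \<inter> E1 = {\<zero>}" "C3 \<inter> E2 = {\<zero>}" "C4 \<inter> E1 = {\<zero>}" "C4 \<inter> E2 = {\<zero>}"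
    "C4 \<inter> C3 = {\<zero>}"
    using ne by (intro disj; simp)+
  have "card E1 > 1" using E1(2) by simp
  then obtain e1 where e1: "e1 \<in> E1" "e1 \<noteq> \<zero>"
    using nonzero_point[OF E1(1)] by blast
  obtain e2 where e2: "e2 \<in> E1" "e2 \<noteq> \<zero>" "e1 \<noteq> e2" "E1 = line e1 e2"
    using line_through[OF E1 e1] by blast
  have c: "e1 \<in> carrier V" "e2 \<in> carrier V"
    using e1 e2 subspaceD(1)[OF E1(1)] by blast+
  obtain f1 where f1: "f1 \<in> E2" "e1 \<oplus> f1 \<in> C3"
    using graph_point[OF V E2 C3 D(3) c(1)] by blast
  obtain f2 where f2: "f2 \<in> E2" "e2 \<oplus> f2 \<in> C3"
    using graph_point[OF V E2 C3 D(3) c(2)] by blast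
  obtain b1 where b1: "b1 \<in> E2" "e1 \<oplus> b1 \<in> C4"
    using graph_point[OF V E2 C4 D(5) c(1)] by blast
  obtain b2 where b2: "b2 \<in> E2" "e2 \<oplus> b2 \<in> C4"
    using graph_point[OF V E2 C4 D(5) c(2)] by blast
  have cf: "f1 \<in> carrier V" "f2 \<in> carrier V" "b1 \<in> carrier V" "b2 \<in> carrier V"
    using f1 f2 b1 b2 subspaceD(1)[OF E2(1)] by blast+
  have E12: "x \<noteq> y" if "x \<in> E1" "x \<noteq> \<zero>" "y \<in> E2" for x y
    using that D(1) by blast
  have nz: "x \<oplus> y \<noteq> \<zero>" if "x \<in> E1" "x \<noteq> \<zero>" "y \<in> E2" for x y
    using E12[OF that] sum_eq_iff(1)[of x y] that subspaceD(1)[OF E1(1)] subspaceD(1)[OF E2(1)] by blast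
  have e12: "e1 \<oplus> e2 \<in> E1" "e1 \<oplus> e2 \<noteq> \<zero>"
    using subspaceD(3)[OF E1(1) e1(1) e2(1)] sum_eq_iff(1)[OF c] e2(3) by simp_all
  have pts: "b \<noteq> \<zero> \<and> b' \<noteq> \<zero> \<and> b \<noteq> b' \<and> C = line (e1 \<oplus> b) (e2 \<oplus> b') \<and> (e1 \<oplus> e2) \<oplus> (b \<oplus> b') \<in> C"
    if C: "C \<in> subspaces F2 V" "card C = 4" "C \<inter> E1 = {\<zero>}" "C \<inter> E2 = {\<zero>}"
      and b: "b \<in> E2" "b' \<in> E2" "e1 \<oplus> b \<in> C" "e2 \<oplus> b' \<in> C" for C b b'
  proof -
    have cb: "b \<in> carrier V" "b' \<in> carrier V"
      using b subspaceD(1)[OF E2(1)] by blast+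
    have s: "(e1 \<oplus> e2) \<oplus> (b \<oplus> b') \<in> C"
      using subspaceD(3)[OF C(1) b(3,4)] add_add_swap[OF c(1) cb(1) c(2) cb(2)] by simp
    have nE: "x \<notin> C" if "x \<in> E1" "x \<noteq> \<zero>" for x
      using that C(3) by blast
    have "b \<noteq> \<zero>" "b' \<noteq> \<zero>"
      using b(3,4) nE[OF e1] nE[OF e2(1,2)] c by auto
    moreover have bb: "b \<noteq> b'"
      using s nE[OF e12] c cb by auto
    moreover have "e1 \<oplus> b \<noteq> e2 \<oplus> b'"
    proof
      assume eq: "e1 \<oplus> b = e2 \<oplus> b'"
      have "(e1 \<oplus> e2) \<oplus> (b \<oplus> b') = (e1 \<oplus> b) \<oplus> (e2 \<oplus> b')"
        using add_add_swap[OF c(1) c(2) cb] .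
      also have "\<dots> = \<zero>" using eq c cb by simp
      finally show False
        using nz[OF e12 subspaceD(3)[OF E2(1) b(1,2)]] by simp
    qed
    ultimately show ?thesis
      using s line_eq[OF C(1,2) b(3,4) nz[OF e1 b(1)] nz[OF e2(1,2) b(2)]] by simp
  qed
  note p3 = pts[OF C3 D(2,3) f1(1) f2(1) f1(2) f2(2)]
  note p4 = pts[OF C4 D(4,5) b1(1) b2(1) b1(2) b2(2)]
  have E2l: "E2 = line f1 f2"
    using line_eq[OF E2 f1(1) f2(1)] p3 by blast
  have n43: "x \<notin> C4" if "x \<in> C3" "x \<noteq> \<zero>" for x
    using that D(6) by blast
  \<comment> \<open>The maps with graphs \<open>C3\<close> and \<open>C4\<close> differ at
    \<open>e1\<close>, \<open>e2\<close> and \<open>e1 \<oplus> e2\<close>; of the candidates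
    for \<open>b1\<close> and \<open>b2\<close> this leaves two pairs.\<close>
  have "b1 \<noteq> f1"
    using n43[OF f1(2) nz[OF e1 f1(1)]] b1(2) by blast
  moreover have "b2 \<noteq> f2"
    using n43[OF f2(2) nz[OF e2(1,2) f2(1)]] b2(2) by blast
  moreover have "b1 \<oplus> b2 \<noteq> f1 \<oplus> f2"
    using n43[OF _ nz[OF e12 subspaceD(3)[OF E2(1) f1(1) f2(1)]]] p3 p4 by auto
  moreover have "f2 \<oplus> f1 = f1 \<oplus> f2"
    using cf by (simp add: M.a_comm)
  moreover have "b1 \<in> {\<zero>, f1, f2, f1 \<oplus> f2}" "b2 \<in> {\<zero>, f1, f2, f1 \<oplus> f2}"
    using b1(1) b2(1) E2l by (simp_all add: line_def)
  ultimately have "(b1 = f2 \<and> b2 = f1 \<oplus> f2) \<or> (b1 = f1 \<oplus> f2 \<and> b2 = f1)"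
    using p4 by auto
  then have "C4 = spread_line_4 e1 e2 f1 f2 \<or> C4 = spread_line_5 e1 e2 f1 f2"
    using p4 unfolding spread_line_4_def spread_line_5_def by auto
  then show thesis
    using that[OF e2(4) E2l _ e1(2) e2(2,3)] p3 e1(1) e2(1) f1(1) f2(1) by blast
qed

end

text \<open>Since \<open>D\<close> vanishes on \<open>E1\<close>, on \<open>E2\<close> and on the
  third line, $D(e_1,f_2)=D(e_2,f_1)$. Expanding bilinearly, the values of \<open>D\<close> on the
  other two lines are $D(e_1,f_1)+D(e_1,f_2)+D(e_2,f_2)$ and $D(e_1,f_1)+D(e_2,f_1)+D(e_2,f_2)$, and
  these agree.\<close>

lemma (in split_qmatroid) spread_lines_rank_iff:
  assumes D: "alternating_rank_form M L D"
    and C: "E1 = line e1 e2" "E2 = line f1 f2" "rk M (line (e1 \<oplus> f1) (e2 \<oplus> f2)) \<le> 1"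
    and e: "e1 \<in> E1" "e2 \<in> E1" and f: "f1 \<in> E2" "f2 \<in> E2"
  shows "rk M (spread_line_4 e1 e2 f1 f2) \<le> 1 \<longleftrightarrow> rk M (spread_line_5 e1 e2 f1 f2) \<le> 1"
proof -
  interpret D: alternating_rank_form M L D by (rule D)
  have c: "e1 \<in> carrier V" "e2 \<in> carrier V" "f1 \<in> carrier V" "f2 \<in> carrier V"
    using e f subspaceD(1)[OF E1(1)] subspaceD(1)[OF E2(1)] by blast+
  note alt = D.alternating[unfolded ground] and add = D.form_add[unfolded ground]
    and sym = D.symmetric[unfolded ground] and rank = D.form_zero_iff[unfolded ground]
  have add': "D z (x \<oplus> y) = D z x \<oplus>\<^bsub>L\<^esub> D z y" if "x \<in> carrier V" "y \<in> carrier V" "z \<in> carrier V" for x y z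
    using add[OF that] sym[of z x] sym[of z y] sym[of z "x \<oplus> y"] that by simp
  have z: "D e1 e2 = \<zero>\<^bsub>L\<^esub>" "D f1 f2 = \<zero>\<^bsub>L\<^esub>"
    using rank[OF c(1,2)] rank[OF c(3,4)] E_circuits unfolding C(1,2)[symmetric] by (simp_all add: circuits_eq)
  have z': "D e2 e1 = \<zero>\<^bsub>L\<^esub>" "D f2 f1 = \<zero>\<^bsub>L\<^esub>"
    using z sym c by auto
  define p q s t where "p = D e1 f1" "q = D e1 f2" "s = D e2 f1" "t = D e2 f2"
  have pc: "p \<in> carrier L" "q \<in> carrier L" "s \<in> carrier L" "t \<in> carrier L"
    using D.form_closed[unfolded ground] c by (simp_all add: p_q_s_t_def)
  have fe: "D f1 e1 = p" "D f2 e1 = q" "D f1 e2 = s" "D f2 e2 = t"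
    using sym c by (simp_all add: p_q_s_t_def)
  note simps = add add' alt z z' fe p_q_s_t_def[symmetric] c pc
  have "D (e1 \<oplus> f1) (e2 \<oplus> f2) = q \<oplus>\<^bsub>L\<^esub> s"
    by (simp add: simps D.L.a_comm)
  then have "q \<oplus>\<^bsub>L\<^esub> s = \<zero>\<^bsub>L\<^esub>"
    using rank[of "e1 \<oplus> f1" "e2 \<oplus> f2"] C(3) c by simp
  then have "s = q"
    using D.double_left[of q s] pc by simp
  then have "D (e1 \<oplus> f2) (e2 \<oplus> (f1 \<oplus> f2)) = D (e1 \<oplus> (f1 \<oplus> f2)) (e2 \<oplus> f1)"
    by (simp add: simps D.L.a_ac)
  then show ?thesis
    unfolding spread_line_4_def spread_line_5_def
    using rank[of "e1 \<oplus> f2" "e2 \<oplus> (f1 \<oplus> f2)"] rank[of "e1 \<oplus> (f1 \<oplus> f2)" "e2 \<oplus> f1"] c by simp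
qed

text \<open>By the normal form one of the two remaining lines of the spread is a circuit, so both
  are. It remains to check that they are distinct and different from the three other circuits: all
  of these lines except \<open>E2\<close> contain a point of the form \<open>e2 \<oplus> b\<close>
  with \<open>b\<close> in \<open>E2\<close>, and the four values of \<open>b\<close> distinguish
  them.\<close>

theorem (in split_qmatroid) not_four_circuits:
  assumes "alternating_rank_form M L D"
  shows "card (circuits_of_dim F2 M 2) \<noteq> 4"
proof
  let ?S = "circuits_of_dim F2 M 2"
  assume four: "card ?S = 4"
  have neE: "E1 \<noteq> E2"
    using E1(2) disjoint by auto
  have "card (?S - {E1, E2}) = 2"
    using four neE E_circuits by (subst card_Diff_subset) (auto simp: card_insert_if)
  then obtain C3 C4 where C: "?S - {E1, E2} = {C3, C4}" "C3 \<noteq> C4"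
    by (auto simp: card_2_iff)
  then have S: "?S = {E1, E2, C3, C4}" and ne: "C3 \<noteq> E1" "C3 \<noteq> E2" "C4 \<noteq> E1" "C4 \<noteq> E2" "C4 \<noteq> C3"
    using E_circuits by blast+
  have sp: "partial_spread V {E1, E2, C3, C4}"
    using circuits_partial_spread unfolding S .
  obtain e1 e2 f1 f2 where l: "E1 = line e1 e2" "E2 = line f1 f2" "C3 = line (e1 \<oplus> f1) (e2 \<oplus> f2)"
    and nz: "e1 \<noteq> \<zero>" "e2 \<noteq> \<zero>" "e1 \<noteq> e2" "f1 \<noteq> \<zero>" "f2 \<noteq> \<zero>" "f1 \<noteq> f2"
    and m: "e1 \<in> E1" "e2 \<in> E1" "f1 \<in> E2" "f2 \<in> E2"
    and C4: "C4 = spread_line_4 e1 e2 f1 f2 \<or> C4 = spread_line_5 e1 e2 f1 f2"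
    using spread_normal_form[OF card_V sp neE ne] by blast
  have c: "e1 \<in> carrier V" "e2 \<in> carrier V" "f1 \<in> carrier V" "f2 \<in> carrier V"
    using m subspaceD(1)[OF E1(1)] subspaceD(1)[OF E2(1)] by blast+
  have sub: "X \<in> subspaces F2 V" if "X \<in> ?S" for X
    using that circuits_eq by blast
  have off: "X \<inter> E2 = {\<zero>}" if "X \<in> ?S" "X \<noteq> E2" for X
    using circuits_partial_spread that E_circuits(2) unfolding partial_spread_def by blast
  have "rk M C3 \<le> 1" "rk M C4 \<le> 1"
    using S circuits_eq by blast+
  then have r: "rk M (spread_line_4 e1 e2 f1 f2) \<le> 1" "rk M (spread_line_5 e1 e2 f1 f2) \<le> 1"
    using spread_lines_rank_iff[OF assms l(1,2) _ m] l(3) C4 by auto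
  have f12: "f1 \<oplus> f2 \<in> E2" "f1 \<oplus> f2 \<noteq> \<zero>" "f1 \<oplus> f2 \<noteq> f1" "f1 \<oplus> f2 \<noteq> f2"
    using subspaceD(3)[OF E2(1) m(3,4)] sum_eq_iff[OF c(3,4)] nz by simp_all
  have line4: "line (e1 \<oplus> b) (e2 \<oplus> b') \<in> ?S"
    if b: "b \<in> E2" "b' \<in> E2" and rb: "rk M (line (e1 \<oplus> b) (e2 \<oplus> b')) \<le> 1" for b b'
  proof -
    have cb: "b \<in> carrier V" "b' \<in> carrier V"
      using b subspaceD(1)[OF E2(1)] by blast+
    note inj = inj_onD[OF direct_sum_inj[OF E1(1) E2(1) disjoint], of "(_, _)" "(_, _)", simplified]
    have "e1 \<oplus> b \<noteq> \<zero> \<oplus> \<zero>" "e2 \<oplus> b' \<noteq> \<zero> \<oplus> \<zero>" "e1 \<oplus> b \<noteq> e2 \<oplus> b'"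
      using inj[of e1 b \<zero> \<zero>] inj[of e2 b' \<zero> \<zero>] inj[of e1 b e2 b'] m b nz
        subspaceD(2)[OF E1(1)] subspaceD(2)[OF E2(1)] by blast+
    then have "card (line (e1 \<oplus> b) (e2 \<oplus> b')) = 4"
      using c cb by (intro card_line) simp_all
    then show ?thesis
      using rb line_subspace[of "e1 \<oplus> b" "e2 \<oplus> b'"] c cb by (simp add: circuits_eq)
  qed
  have in4: "spread_line_4 e1 e2 f1 f2 \<in> ?S" and in5: "spread_line_5 e1 e2 f1 f2 \<in> ?S"
    using line4[OF m(4) f12(1)] line4[OF f12(1) m(3)] r by (simp_all add: spread_line_4_def spread_line_5_def)
  \<comment> \<open>A point over \<open>e2\<close> on every line except \<open>E2\<close>; the
    second summands are pairwise distinct.\<close>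
  have pt4: "e2 \<oplus> (f1 \<oplus> f2) \<in> spread_line_4 e1 e2 f1 f2" and pt5: "e2 \<oplus> f1 \<in> spread_line_5 e1 e2 f1 f2"
    and pt3: "e2 \<oplus> f2 \<in> C3" and pt1: "e2 \<oplus> \<zero> \<in> E1"
    using m c by (simp_all add: spread_line_4_def spread_line_5_def l(3) mem_line)
  have neq: "X \<noteq> Y"
    if "X \<in> ?S" "Y \<noteq> E2" "e2 \<oplus> b \<in> X" "e2 \<oplus> b' \<in> Y" "b \<in> E2" "b' \<in> E2" "b \<noteq> b'" for X Y b b'
    using graph_unique[OF sub E2(1) off c(2), of X b b'] that by blast
  have nE2: "spread_line_4 e1 e2 f1 f2 \<noteq> E2" "spread_line_5 e1 e2 f1 f2 \<noteq> E2"
  proof -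
    have "e2 \<oplus> b \<notin> E2" if b: "b \<in> E2" for b
    proof
      assume "e2 \<oplus> b \<in> E2"
      then have "(e2 \<oplus> b) \<oplus> b \<in> E2" using b subspaceD(3)[OF E2(1)] by blast
      moreover have "(e2 \<oplus> b) \<oplus> b = e2"
        using b c subspaceD(1)[OF E2(1)] by (simp add: M.a_assoc subset_iff)
      ultimately show False using m(2) nz(2) disjoint by auto
    qed
    then show "spread_line_4 e1 e2 f1 f2 \<noteq> E2" "spread_line_5 e1 e2 f1 f2 \<noteq> E2"
      using pt4 pt5 f12(1) m(3) by blast+
  qed
  have zE: "\<zero> \<in> E2" using subspaceD(2)[OF E2(1)] .
  have "spread_line_4 e1 e2 f1 f2 \<notin> {E1, C3}" "spread_line_5 e1 e2 f1 f2 \<notin> {E1, C3}"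
    "spread_line_4 e1 e2 f1 f2 \<noteq> spread_line_5 e1 e2 f1 f2"
    using neq[OF in4 neE pt4 pt1 f12(1) zE f12(2)] neq[OF in4 ne(2) pt4 pt3 f12(1) m(4) f12(4)]
      neq[OF in5 neE pt5 pt1 m(3) zE nz(4)] neq[OF in5 ne(2) pt5 pt3 m(3,4) nz(6)]
      neq[OF in4 nE2(2) pt4 pt5 f12(1) m(3) f12(3)] by blast+
  then show False
    using in4 in5 nE2 unfolding S by blast
qed

section \<open>The dichotomy\<close>

text \<open>Besides \<open>E1\<close> and \<open>E2\<close>, take the graphs of two bijections from
  \<open>E1\<close> to \<open>E2\<close> that differ by a cyclic permutation of the nonzero points
  of \<open>E2\<close>. Disjointness is checked on pairs in the product of \<open>E1\<close> and
  \<open>E2\<close>.\<close>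

lemma (in binary_space) four_line_spread:
  assumes E1: "E1 \<in> subspaces F2 V" "card E1 = 4" and E2: "E2 \<in> subspaces F2 V" "card E2 = 4"
    and disjoint: "E1 \<inter> E2 = {\<zero>}"
  obtains S where "partial_spread V S" "card S = 4" "E1 \<in> S" "E2 \<in> S"
proof -
  define g where "g = (\<lambda>(a, b). a \<oplus> b)"
  have inj: "inj_on g (E1 \<times> E2)"
    unfolding g_def by (rule direct_sum_inj[OF E1(1) E2(1) disjoint])
  have "card E1 > 1" "card E2 > 1" using E1(2) E2(2) by simp_all
  then obtain e1 f1 where e1: "e1 \<in> E1" "e1 \<noteq> \<zero>" and f1: "f1 \<in> E2" "f1 \<noteq> \<zero>"
    using nonzero_point[OF E1(1)] nonzero_point[OF E2(1)] by metis
  obtain e2 where e2: "e2 \<in> E1" "e2 \<noteq> \<zero>" "e1 \<noteq> e2" "E1 = line e1 e2"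
    using line_through[OF E1 e1] by blast
  obtain f2 where f2: "f2 \<in> E2" "f2 \<noteq> \<zero>" "f1 \<noteq> f2" "E2 = line f1 f2"
    using line_through[OF E2 f1] by blast
  define e3 f3 where "e3 = e1 \<oplus> e2" "f3 = f1 \<oplus> f2"
  have c: "e1 \<in> carrier V" "e2 \<in> carrier V" "f1 \<in> carrier V" "f2 \<in> carrier V"
    using e1 e2 f1 f2 subspaceD(1)[OF E1(1)] subspaceD(1)[OF E2(1)] by blast+
  have c3: "e3 \<in> carrier V" "f3 \<in> carrier V" using c by (simp_all add: e3_f3_def)
  have E: "E1 = {\<zero>, e1, e2, e3}" "E2 = {\<zero>, f1, f2, f3}"
    using e2(4) f2(4) by (simp_all add: line_def e3_f3_def)
  have ne: "e3 \<noteq> \<zero>" "e3 \<noteq> e1" "e3 \<noteq> e2" "f3 \<noteq> \<zero>" "f3 \<noteq> f1" "f3 \<noteq> f2"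
    using sum_eq_iff[OF c(1,2)] sum_eq_iff[OF c(3,4)] e1(2) e2(2,3) f1(2) f2(2,3) by (simp_all add: e3_f3_def)
  \<comment> \<open>The four lines as sets of pairs, with the cyclic permutation in the last
    one.\<close>
  define P1 where "P1 = {(\<zero>, \<zero>), (e1, \<zero>), (e2, \<zero>), (e3, \<zero>)}"
  define P2 where "P2 = {(\<zero>, \<zero>), (\<zero>, f1), (\<zero>, f2), (\<zero>, f3)}"
  define P3 where "P3 = {(\<zero>, \<zero>), (e1, f1), (e2, f2), (e3, f3)}"
  define P4 where "P4 = {(\<zero>, \<zero>), (e1, f2), (e2, f3), (e3, f1)}"
  define PS where "PS = {P1, P2, P3, P4}"
  note Pdef = PS_def P1_def P2_def P3_def P4_def
  note dist = e1(2) e2(2,3) f1(2) f2(2,3) ne ne[symmetric] e1(2)[symmetric] e2(2,3)[symmetric]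
    f1(2)[symmetric] f2(2,3)[symmetric]
  have sub: "P \<subseteq> E1 \<times> E2" if "P \<in> PS" for P
    using that unfolding Pdef E by auto
  have g1: "g ` P1 = E1" and g2: "g ` P2 = E2"
    using c c3 by (simp_all add: g_def P1_def P2_def E)
  have g3: "g ` P3 = line (e1 \<oplus> f1) (e2 \<oplus> f2)"
    using c by (simp add: g_def P3_def line_def e3_f3_def add_add_swap)
  have "(e1 \<oplus> f2) \<oplus> (e2 \<oplus> f3) = e3 \<oplus> f1"
    using c by (simp add: e3_f3_def M.a_ac)
  then have g4: "g ` P4 = line (e1 \<oplus> f2) (e2 \<oplus> f3)"
    using c by (simp add: g_def P4_def line_def)
  have "g ` P \<in> subspaces F2 V" if "P \<in> PS" for P
  proof -
    have "g ` P3 \<in> subspaces F2 V" "g ` P4 \<in> subspaces F2 V"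
      unfolding g3 g4 using c c3 by (intro line_subspace; simp)+
    then show ?thesis
      using that g1 g2 E1(1) E2(1) by (auto simp: PS_def)
  qed
  moreover have "card (g ` P) = 4" if "P \<in> PS" for P
  proof -
    have "card P = 4" using that dist unfolding Pdef by auto
    then show ?thesis using card_image[OF inj_on_subset[OF inj sub[OF that]]] by simp
  qed
  moreover have meet: "g ` P \<inter> g ` Q = {\<zero>}" if "P \<in> PS" "Q \<in> PS" "P \<noteq> Q" for P Q
  proof -
    have "P \<inter> Q = {(\<zero>, \<zero>)}"
      using that dist unfolding Pdef by auto
    then have "g ` P \<inter> g ` Q = g ` {(\<zero>, \<zero>)}"
      using inj_on_image_Int[OF inj sub[OF that(1)] sub[OF that(2)]] by simp
    then show ?thesis by (simp add: g_def)
  qed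
  moreover have "g ` P \<inter> g ` Q = {\<zero>}" if "P \<in> PS" "Q \<in> PS" "g ` P \<noteq> g ` Q" for P Q
    using meet[OF that(1,2)] that(3) by blast
  ultimately have "partial_spread V ((`) g ` PS)"
    unfolding partial_spread_def by blast
  moreover have "card ((`) g ` PS) = 4"
  proof -
    have "(e1, \<zero>) \<in> P1" "(e1, \<zero>) \<notin> P2" "(e1, \<zero>) \<notin> P3" "(e1, \<zero>) \<notin> P4"
      "(\<zero>, f1) \<in> P2" "(\<zero>, f1) \<notin> P3" "(\<zero>, f1) \<notin> P4" "(e1, f1) \<in> P3" "(e1, f1) \<notin> P4"
      using dist by (simp_all add: P1_def P2_def P3_def P4_def)
    then have "P1 \<noteq> P2" "P1 \<noteq> P3" "P1 \<noteq> P4" "P2 \<noteq> P3" "P2 \<noteq> P4" "P3 \<noteq> P4"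
      by blast+
    then have "card PS = 4" by (simp add: PS_def)
    moreover have "inj_on ((`) g) PS"
      using inj_on_image_eq_iff[OF inj sub sub] by (intro inj_onI) blast
    ultimately show ?thesis by (simp add: card_image)
  qed
  moreover have "E1 \<in> (`) g ` PS" "E2 \<in> (`) g ` PS"
    using g1 g2 unfolding PS_def by blast+
  ultimately show thesis using that by blast
qed

lemma split_qmatroidI:
  assumes M: "qmatroid F2 M" "ground M = V" and V: "binary_space V" "card (carrier V) = 16"
    and E1: "E1 \<in> subspaces F2 V" "card E1 = 4" and E2: "E2 \<in> subspaces F2 V" "card E2 = 4"
    and disjoint: "E1 \<inter> E2 = {\<zero>\<^bsub>V\<^esub>}"
    and iso: "isomorphic F2 (restriction M E1) (uniform F2 1 2)" "isomorphic F2 (restriction M E2) (uniform F2 1 2)"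
      "isomorphic F2 (contraction M E1) (uniform F2 1 2)"
  shows "split_qmatroid M V E1 E2"
proof (rule split_qmatroid.intro)
  interpret binary_space V by fact
  note r1 = restriction_uniform_rank[of M E1, unfolded M(2), OF V(1) E1(1) iso(1)]
  note r2 = restriction_uniform_rank[of M E2, unfolded M(2), OF V(1) E2(1) iso(2)]
  show "rk M A = 1" if "A \<in> subspaces F2 V" "A \<subseteq> E1" "A \<noteq> {\<zero>\<^bsub>V\<^esub>}" for A
    using r1[OF that(1,2)] that(3) by simp
  show "rk M A = 1" if "A \<in> subspaces F2 V" "A \<subseteq> E2" "A \<noteq> {\<zero>\<^bsub>V\<^esub>}" for A
    using r2[OF that(1,2)] that(3) by simp
  have "E1 \<noteq> {\<zero>\<^bsub>V\<^esub>}" "E1 \<noteq> carrier V" using E1(2) V(2) by auto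
  then show "rk M (carrier V) = 2"
    using contraction_uniform_rank[of M E1, unfolded M(2), OF V(1) E1(1) _ iso(3)] r1[OF E1(1)] by simp
qed fact+

theorem theorem19:
  fixes E1 E2 :: "(nat \<Rightarrow> bit) set"
  assumes "E1 \<in> subspaces F2 (coord_space F2 4)" and "E2 \<in> subspaces F2 (coord_space F2 4)"
    and "sdim F2 (coord_space F2 4) E1 = 2" and "sdim F2 (coord_space F2 4) E2 = 2"
    and "E1 \<inter> E2 = {\<zero>\<^bsub>coord_space F2 4\<^esub>}"
    and "E1 <+>\<^bsub>coord_space F2 4\<^esub> E2 = carrier (coord_space F2 4)"
  shows "(\<forall>M. qmatroid F2 M \<and> ground M = coord_space F2 4 \<and>
              isomorphic F2 (restriction M E1) (uniform F2 1 2) \<and>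
              isomorphic F2 (contraction M E2) (uniform F2 1 2) \<and>
              isomorphic F2 (restriction M E2) (uniform F2 1 2) \<and>
              isomorphic F2 (contraction M E1) (uniform F2 1 2) \<and>
              representable F2 4 M \<longrightarrow>
              card (circuits_of_dim F2 M 2) \<noteq> 4)
       \<and> (\<exists>M. qmatroid F2 M \<and> ground M = coord_space F2 4 \<and>
              isomorphic F2 (restriction M E1) (uniform F2 1 2) \<and>
              isomorphic F2 (contraction M E2) (uniform F2 1 2) \<and>
              isomorphic F2 (restriction M E2) (uniform F2 1 2) \<and>
              isomorphic F2 (contraction M E1) (uniform F2 1 2) \<and>
              card (circuits_of_dim F2 M 2) = 4 \<and>
              \<not> representable F2 4 M)"
proof -
  let ?V = "coord_space F2 4"
  have V: "binary_space ?V" "card (carrier ?V) = 16"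
    using coord_binary_space card_coord_space[of 4] by simp_all
  interpret binary_space ?V by (rule V(1))
  have E1: "E1 \<in> subspaces F2 ?V" "card E1 = 4" and E2: "E2 \<in> subspaces F2 ?V" "card E2 = 4"
    using assms(1-4) sdim_iff(3) by simp_all
  have not_four: "card (circuits_of_dim F2 M 2) \<noteq> 4"
    if "qmatroid F2 M" "ground M = ?V" "isomorphic F2 (restriction M E1) (uniform F2 1 2)"
      "isomorphic F2 (restriction M E2) (uniform F2 1 2)" "isomorphic F2 (contraction M E1) (uniform F2 1 2)"
      and rep: "representable F2 4 M" for M
  proof -
    interpret split_qmatroid M ?V E1 E2
      using split_qmatroidI[OF that(1,2) V E1 E2 assms(5) that(3-5)] .
    obtain L :: "(bit + nat) ring" and D where "alternating_rank_form M L D"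
      using representable_form[OF rep] rank_V unfolding ground by blast
    then show ?thesis by (rule not_four_circuits)
  qed
  obtain S where S: "partial_spread ?V S" "card S = 4" "E1 \<in> S" "E2 \<in> S"
    using four_line_spread[OF E1 E2 assms(5)] by blast
  define M where "M = spread_qmat ?V S"
  have M: "qmatroid F2 M" "ground M = ?V"
      "isomorphic F2 (restriction M E1) (uniform F2 1 2)" "isomorphic F2 (contraction M E2) (uniform F2 1 2)"
      "isomorphic F2 (restriction M E2) (uniform F2 1 2)" "isomorphic F2 (contraction M E1) (uniform F2 1 2)"
      "card (circuits_of_dim F2 M 2) = 4"
    unfolding M_def using spread_qmatroid[OF V(1) S(1)] spread_circuits[OF V(1) S(1)] S(2)
      spread_restriction[OF V(1) S(1,3)] spread_contraction[OF V S(1,4)]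
      spread_restriction[OF V(1) S(1,4)] spread_contraction[OF V S(1,3)]
    by simp_all
  have "\<not> representable F2 4 M"
    using not_four[OF M(1,2,3,5,6)] M(7) by blast
  then show ?thesis
    using not_four M by blast
qed

end
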